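(* Let $X$ be an affine toric variety over $\mathbb{K}$ of dimension $\ge 2$ with $\mathbb{K}[X]^\times=\mathbb{K}^\times$. Then the group $\mathrm{Aut}(X)$ is not finite-dimensional.
   Context: $\mathbb{K}$ is an algebraically closed field of characteristic zero. A toric variety is a normal irreducible variety admitting an action of an algebraic torus with an open orbit. For an affine variety $X$, the automorphism group $\mathrm{Aut}(X)$ is said to be finite-dimensional if $\mathrm{Aut}(X)$ has a structure of an affine algebraic group such that the action $\mathrm{Aut}(X)\times X\to X$ is algebraic. *)

theory Defs
  imports
    "HOL-Algebra.Group_Action"
    "HOL-Algebra.Ring"
    "HOL-Computational_Algebra.Polynomial"
    "HOL-Library.Extended_Nat"
begin

section \<open>Affine varieties\<close>

text \<open>
  Points of affine \<open>n\<close>-space over \<open>'k\<close> are the lists of length \<open>n\<close>, so that the product of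
  \<open>X \<subseteq> \<A>\<^sup>m\<close> and \<open>Y \<subseteq> \<A>\<^sup>n\<close> is embedded in \<open>\<A>\<^sup>m\<^sup>+\<^sup>n\<close> by concatenation.
  An affine variety is a Zariski closed subset of some \<open>\<A>\<^sup>n\<close>; it need not be irreducible.
\<close>

definition affine_space :: "nat \<Rightarrow> 'k list set" where
  "affine_space n = {x. length x = n}"

inductive_set poly_functions :: "nat \<Rightarrow> ('k::comm_ring_1 list \<Rightarrow> 'k) set" for n :: nat where
  const: "(\<lambda>x. c) \<in> poly_functions n"
| coordinate: "i < n \<Longrightarrow> (\<lambda>x. x ! i) \<in> poly_functions n"
| add: "p \<in> poly_functions n \<Longrightarrow> q \<in> poly_functions n \<Longrightarrow> (\<lambda>x. p x + q x) \<in> poly_functions n"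
| mult: "p \<in> poly_functions n \<Longrightarrow> q \<in> poly_functions n \<Longrightarrow> (\<lambda>x. p x * q x) \<in> poly_functions n"

definition zariski_closed :: "nat \<Rightarrow> 'k::field list set \<Rightarrow> bool" where
  "zariski_closed n X \<longleftrightarrow>
    (\<exists>S \<subseteq> poly_functions n. X = {x \<in> affine_space n. \<forall>p\<in>S. p x = 0})"

definition open_in_variety :: "nat \<Rightarrow> 'k::field list set \<Rightarrow> 'k list set \<Rightarrow> bool" where
  "open_in_variety n X U \<longleftrightarrow> U \<subseteq> X \<and> zariski_closed n (X - U)"

definition irreducible_variety :: "nat \<Rightarrow> 'k::field list set \<Rightarrow> bool" where
  "irreducible_variety n X \<longleftrightarrow> zariski_closed n X \<and> X \<noteq> {} \<and>
    (\<forall>Y Z. zariski_closed n Y \<longrightarrow> zariski_closed n Z \<longrightarrow> X = Y \<union> Z \<longrightarrow> X = Y \<or> X = Z)"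

text \<open>The Krull dimension of the Zariski topology on \<open>X\<close>.\<close>

definition variety_dim :: "nat \<Rightarrow> 'k::field list set \<Rightarrow> enat" where
  "variety_dim n X = Sup {enat d | d. \<exists>Z :: nat \<Rightarrow> 'k list set.
    (\<forall>i\<le>d. irreducible_variety n (Z i) \<and> Z i \<subseteq> X) \<and> (\<forall>i<d. Z i \<subset> Z (Suc i))}"

definition coord_ring :: "nat \<Rightarrow> 'k::field list set \<Rightarrow> ('k list \<Rightarrow> 'k) ring" where
  "coord_ring n X =
    \<lparr>carrier = {restrict p X | p. p \<in> poly_functions n},
     monoid.mult = (\<lambda>f g. \<lambda>x\<in>X. f x * g x),
     one = (\<lambda>x\<in>X. 1),
     zero = (\<lambda>x\<in>X. 0),
     add = (\<lambda>f g. \<lambda>x\<in>X. f x + g x)\<rparr>"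

definition morphism :: "nat \<Rightarrow> 'k::field list set \<Rightarrow> nat \<Rightarrow> 'k list set \<Rightarrow> ('k list \<Rightarrow> 'k list) \<Rightarrow> bool"
  where "morphism m X n Y f \<longleftrightarrow> f ` X \<subseteq> Y \<and>
    (\<forall>j<n. (\<lambda>x\<in>X. f x ! j) \<in> carrier (coord_ring m X))"

definition variety_prod :: "'k list set \<Rightarrow> 'k list set \<Rightarrow> 'k list set" where
  "variety_prod X Y = {x @ y | x y. x \<in> X \<and> y \<in> Y}"

text \<open>
  For irreducible \<open>X\<close>, an element of the function field \<open>\<bbbK>(X)\<close> is a quotient \<open>a / b\<close> with
  \<open>a, b \<in> \<bbbK>[X]\<close>, \<open>b \<noteq> 0\<close>, regarded as a function on the dense open set where \<open>b\<close> does not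
  vanish; identities in \<open>\<bbbK>(X)\<close> involving only \<open>a / b\<close> and elements of \<open>\<bbbK>[X]\<close> can be tested
  pointwise there.
\<close>

definition integral_quotient ::
  "nat \<Rightarrow> 'k::field list set \<Rightarrow> ('k list \<Rightarrow> 'k) \<Rightarrow> ('k list \<Rightarrow> 'k) \<Rightarrow> bool" where
  "integral_quotient n X a b \<longleftrightarrow>
    (\<exists>d\<ge>1. \<exists>c :: nat \<Rightarrow> 'k list \<Rightarrow> 'k. (\<forall>i<d. c i \<in> carrier (coord_ring n X)) \<and>
      (\<forall>x\<in>X. b x \<noteq> 0 \<longrightarrow> (a x / b x) ^ d + (\<Sum>i<d. c i x * (a x / b x) ^ i) = 0))"

text \<open>Normality: \<open>\<bbbK>[X]\<close> is integrally closed in its field of fractions \<open>\<bbbK>(X)\<close>.\<close>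

definition normal_variety :: "nat \<Rightarrow> 'k::field list set \<Rightarrow> bool" where
  "normal_variety n X \<longleftrightarrow> irreducible_variety n X \<and>
    (\<forall>a\<in>carrier (coord_ring n X). \<forall>b\<in>carrier (coord_ring n X).
      b \<noteq> \<zero>\<^bsub>coord_ring n X\<^esub> \<longrightarrow> integral_quotient n X a b \<longrightarrow>
      (\<exists>h\<in>carrier (coord_ring n X). \<forall>x\<in>X. b x \<noteq> 0 \<longrightarrow> a x / b x = h x))"


section \<open>Affine algebraic groups and their actions\<close>

definition affine_algebraic_group :: "nat \<Rightarrow> 'k::field list monoid \<Rightarrow> bool" where
  "affine_algebraic_group m G \<longleftrightarrow> group G \<and> zariski_closed m (carrier G) \<and>
    morphism (m + m) (variety_prod (carrier G) (carrier G)) m (carrier G)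
      (\<lambda>z. take m z \<otimes>\<^bsub>G\<^esub> drop m z) \<and>
    morphism m (carrier G) m (carrier G) (\<lambda>g. inv\<^bsub>G\<^esub> g)"

definition algebraic_group_iso ::
  "nat \<Rightarrow> 'k::field list monoid \<Rightarrow> nat \<Rightarrow> 'k list monoid \<Rightarrow> ('k list \<Rightarrow> 'k list) \<Rightarrow> bool" where
  "algebraic_group_iso m G l H f \<longleftrightarrow> f \<in> iso G H \<and>
    morphism m (carrier G) l (carrier H) f \<and>
    morphism l (carrier H) m (carrier G) (inv_into (carrier G) f)"

definition algebraic_action ::
  "nat \<Rightarrow> 'k::field list monoid \<Rightarrow> nat \<Rightarrow> 'k list set \<Rightarrow> ('k list \<Rightarrow> 'k list \<Rightarrow> 'k list) \<Rightarrow> bool" where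
  "algebraic_action m G n X \<phi> \<longleftrightarrow> group_action G X \<phi> \<and>
    morphism (m + n) (variety_prod (carrier G) X) n X (\<lambda>z. \<phi> (take m z) (drop m z))"

text \<open>
  \<open>(\<bbbK>\<^sup>\<times>)\<^sup>r\<close> as a closed subset of \<open>\<A>\<^sup>2\<^sup>r\<close>: the point \<open>(t\<^sub>1, \<dots>, t\<^sub>r)\<close> is represented by the list
  \<open>[t\<^sub>1, \<dots>, t\<^sub>r, t\<^sub>1\<inverse>, \<dots>, t\<^sub>r\<inverse>]\<close>.
\<close>

definition standard_torus :: "nat \<Rightarrow> 'k::field list monoid" where
  "standard_torus r =
    \<lparr>carrier = {t. length t = 2 * r \<and> (\<forall>i<r. t ! i * t ! (r + i) = 1)},
     monoid.mult = map2 (*),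
     one = replicate (2 * r) 1\<rparr>"

definition algebraic_torus :: "nat \<Rightarrow> 'k::field list monoid \<Rightarrow> bool" where
  "algebraic_torus m T \<longleftrightarrow> affine_algebraic_group m T \<and>
    (\<exists>r f. algebraic_group_iso m T (2 * r) (standard_torus r) f)"

definition affine_toric_variety :: "nat \<Rightarrow> 'k::field list set \<Rightarrow> bool" where
  "affine_toric_variety n X \<longleftrightarrow> irreducible_variety n X \<and> normal_variety n X \<and>
    (\<exists>m T \<phi>. algebraic_torus m T \<and> algebraic_action m T n X \<phi> \<and>
      (\<exists>x\<in>X. open_in_variety n X (orbit T \<phi> x)))"


section \<open>Automorphism groups\<close>

definition variety_aut_group :: "nat \<Rightarrow> 'k::field list set \<Rightarrow> ('k list \<Rightarrow> 'k list) monoid" where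
  "variety_aut_group n X = (BijGroup X)
    \<lparr>carrier := {f \<in> Bij X. morphism n X n X f \<and> morphism n X n X (inv_into X f)}\<rparr>"

text \<open>
  A structure of an affine algebraic group on \<open>Aut(X)\<close> is given by a group isomorphism \<open>\<psi>\<close> from an
  affine algebraic group \<open>G\<close>; the natural action \<open>(f, x) \<mapsto> f x\<close> of \<open>Aut(X)\<close> then becomes
  \<open>(g, x) \<mapsto> \<psi> g x\<close>.
\<close>

definition aut_finite_dimensional :: "nat \<Rightarrow> 'k::field list set \<Rightarrow> bool" where
  "aut_finite_dimensional n X \<longleftrightarrow>
    (\<exists>m G \<psi>. affine_algebraic_group m G \<and> \<psi> \<in> iso G (variety_aut_group n X) \<and>
      algebraic_action m G n X \<psi>)"

end

theory Submission
  imports Defs "HOL-Library.Function_Algebras"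
begin

text \<open>
  Why the theorem holds. Let a torus act on \<open>X\<close> with open orbit through \<open>x\<^sub>0\<close>. Since \<open>X\<close> is irreducible,
  the orbit is dense, so a regular function is determined by its values on the orbit, and pulling back
  along \<open>t \<mapsto> t x\<^sub>0\<close> embeds \<open>\<bbbK>[X]\<close> into the Laurent polynomials. The image is stable under
  translations, and distinct characters are linearly independent; hence the image is spanned by the
  characters \<open>\<chi>\<^sup>m\<close> that it contains. Their exponents form a monoid \<open>S \<subseteq> \<int>\<^sup>r\<close>, called \<open>weights\<close> below. It is
  finitely generated because \<open>\<bbbK>[X]\<close> is; it is saturated in the group that it generates because \<open>X\<close> is
  normal; and \<open>0\<close> is its only invertible element because all units of \<open>\<bbbK>[X]\<close> are constant.

  The rest is convex geometry of \<open>S\<close>. A maximal proper face of \<open>S\<close> is a facet: modulo the face, \<open>S\<close> has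
  rank one, which yields an additive height function \<open>p : S \<rightarrow> \<nat>\<close> vanishing exactly on the face, and a
  Demazure root \<open>e\<close>, that is, an exponent with \<open>p(e) = -1\<close> which can be added to each \<open>m \<in> S\<close> of positive
  height without leaving \<open>S\<close> (\<open>demazure_root\<close>). If the face is \<open>0\<close>, then \<open>S\<close> is generated by one element (\<open>ray_or_root\<close>),
  every regular function on \<open>X\<close> is a polynomial in a single injective function, and \<open>dim X \<le> 1\<close>
  (\<open>dim_one_weight\<close>). So in dimension at least two the face contains some \<open>w \<noteq> 0\<close>, and then
  \<open>e + k w\<close> is a Demazure root for every \<open>k\<close>.

  A Demazure root \<open>e\<close> gives a one-parameter group of automorphisms of \<open>X\<close>, which acts on functions by
  \<open>\<chi>\<^sup>m \<mapsto> \<chi>\<^sup>m (1 + s \<chi>\<^sup>e)\<^bsup>p(m)\<^esup>\<close>; this is the exponential of the locally nilpotent derivation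
  \<open>\<chi>\<^sup>m \<mapsto> p(m) \<chi>\<^bsup>m+e\<^esup>\<close>. If \<open>Aut(X)\<close> were an affine algebraic group acting algebraically, all translates
  of a fixed function \<open>f\<close> would lie in one finite-dimensional space and thus involve only finitely many
  characters (\<open>algebraic_action_bounded_exponents\<close>). But for \<open>f = \<chi>\<^sup>m\<close> with \<open>p(m) > 0\<close> the root \<open>e + k w\<close>
  produces the character with exponent \<open>m + p(m) (e + k w)\<close>, and these exponents are pairwise distinct.
\<close>

section \<open>Dickson's lemma\<close>

text \<open>
  The value of a vector in the new coordinate \<open>j\<close> either is at least all values occurring in a basis \<open>B\<close> for
  the old coordinates, and then \<open>B\<close> serves, or it is one of finitely many numbers, and each of the
  slices with a fixed value has a basis by induction.
\<close>

lemma dickson: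
  fixes val :: "'v \<Rightarrow> 'j \<Rightarrow> nat"
  assumes "finite J"
  shows "\<exists>B. finite B \<and> B \<subseteq> V \<and> (\<forall>v\<in>V. \<exists>b\<in>B. \<forall>j\<in>J. val b j \<le> val v j)"
  using assms
proof (induction J arbitrary: V rule: finite_induct)
  case empty
  show ?case
  proof (cases "V = {}")
    case False
    then obtain v where "v \<in> V" by blast
    then show ?thesis by (intro exI[of _ "{v}"]) auto
  qed auto
next
  case (insert j J)
  obtain B where B: "finite B" "B \<subseteq> V" "\<And>v. v \<in> V \<Longrightarrow> \<exists>b\<in>B. \<forall>j\<in>J. val b j \<le> val v j"
    using insert.IH[of V] by blast
  have "\<exists>C. \<forall>k. finite (C k) \<and> C k \<subseteq> {v \<in> V. val v j = k} \<and>
      (\<forall>v\<in>{v \<in> V. val v j = k}. \<exists>b\<in>C k. \<forall>j\<in>J. val b j \<le> val v j)"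
  proof (rule choice, rule allI)
    fix k
    show "\<exists>C. finite C \<and> C \<subseteq> {v \<in> V. val v j = k} \<and>
      (\<forall>v\<in>{v \<in> V. val v j = k}. \<exists>b\<in>C. \<forall>j\<in>J. val b j \<le> val v j)"
      by (rule insert.IH)
  qed
  then obtain C where "\<forall>k. finite (C k) \<and> C k \<subseteq> {v \<in> V. val v j = k} \<and>
      (\<forall>v\<in>{v \<in> V. val v j = k}. \<exists>b\<in>C k. \<forall>j\<in>J. val b j \<le> val v j)" ..
  then have C: "\<And>k. finite (C k)" "\<And>k. C k \<subseteq> {v \<in> V. val v j = k}"
    "\<And>v. v \<in> V \<Longrightarrow> \<exists>b\<in>C (val v j). \<forall>j\<in>J. val b j \<le> val v j"
    by simp_all
  have "finite ((\<lambda>b. val b j) ` B)" using B(1) by simp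
  then obtain N where N: "\<forall>b\<in>B. val b j \<le> N"
    unfolding finite_nat_set_iff_bounded_le ball_simps(9) ..
  define D where "D = B \<union> (\<Union>k<N. C k)"
  have "\<exists>b\<in>D. \<forall>i\<in>insert j J. val b i \<le> val v i" if "v \<in> V" for v
  proof (cases "val v j < N")
    case True
    obtain b where b: "b \<in> C (val v j)" "\<forall>i\<in>J. val b i \<le> val v i" using C(3)[OF \<open>v \<in> V\<close>] ..
    then have "val b j = val v j" using C(2) by blast
    then show ?thesis using b True unfolding D_def by (intro bexI[of _ b]) auto
  next
    case False
    obtain b where "b \<in> B" "\<forall>j\<in>J. val b j \<le> val v j" using B(3)[OF \<open>v \<in> V\<close>] by blast
    then show ?thesis using N False unfolding D_def by (intro bexI[of _ b]) auto
  qed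
  moreover have "finite D" "D \<subseteq> V" using B(1,2) C(1,2) unfolding D_def by auto
  ultimately show ?case by (intro exI[of _ D]) simp
qed

section \<open>Facets of saturated monoids and Demazure roots\<close>

text \<open>
  Lattices are modelled by commutative rings; the multiplication only serves to write the multiple
  \<open>k a\<close> as \<open>of_nat k * a\<close>. In the application, the ring is \<open>nat \<Rightarrow> int\<close> with pointwise operations.
\<close>

lemma submonoid_mult:
  fixes S :: "'g::comm_ring_1 set"
  assumes "0 \<in> S" "\<And>a b. a \<in> S \<Longrightarrow> b \<in> S \<Longrightarrow> a + b \<in> S" "a \<in> S"
  shows "of_nat k * a \<in> S"
  using assms by (induction k) (auto simp: algebra_simps)

lemma submonoid_sum:
  fixes S :: "'g::comm_ring_1 set"
  assumes "0 \<in> S" "\<And>a b. a \<in> S \<Longrightarrow> b \<in> S \<Longrightarrow> a + b \<in> S" "\<And>i. i \<in> I \<Longrightarrow> g i \<in> S"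
  shows "sum g I \<in> S"
  using assms(3) by (induction I rule: infinite_finite_induct) (auto intro: assms)

lemma root_descent:
  fixes S :: "'g::comm_ring_1 set" and p :: "'g \<Rightarrow> nat"
  assumes "\<And>m. m \<in> S \<Longrightarrow> p m > 0 \<Longrightarrow> m + e \<in> S \<and> p m = Suc (p (m + e))"
    and "m \<in> S" "j \<le> p m"
  shows "m + of_nat j * e \<in> S \<and> p m = j + p (m + of_nat j * e)"
  using assms(3)
proof (induction j)
  case (Suc j)
  then have "m + of_nat j * e \<in> S" "p m = j + p (m + of_nat j * e)" by auto
  then show ?case using assms(1)[of "m + of_nat j * e"] Suc.prems by (auto simp: algebra_simps)
qed (use assms in auto)

text \<open>
  The monoid of those characters of a torus that extend to regular functions on a toric variety: saturation is
  normality of the variety, and pointedness says that its invertible functions are constant.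
\<close>

locale fg_monoid =
  fixes S A :: "'g::comm_ring_1 set"
  assumes zero: "0 \<in> S"
    and add: "a \<in> S \<Longrightarrow> b \<in> S \<Longrightarrow> a + b \<in> S"
    and finite_gen: "finite A"
    and gen_subset: "A \<subseteq> S"
    and generated: "m \<in> S \<Longrightarrow> \<exists>c. m = (\<Sum>a\<in>A. of_nat (c a) * a)"
    and saturated: "a \<in> S \<Longrightarrow> b \<in> S \<Longrightarrow> k > 0 \<Longrightarrow> of_nat k * (a - b) \<in> S \<Longrightarrow> a - b \<in> S"
    and pointed: "a \<in> S \<Longrightarrow> - a \<in> S \<Longrightarrow> a = 0"
begin

lemma mult: "a \<in> S \<Longrightarrow> of_nat k * a \<in> S"
  by (rule submonoid_mult) (auto intro: zero add)

lemma gen_sum: "B \<subseteq> S \<Longrightarrow> (\<Sum>a\<in>B. of_nat (c a) * a) \<in> S"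
  by (rule submonoid_sum) (auto intro: zero add mult)

lemma split_generator:
  assumes "a \<in> A" "c a > 0"
  shows "(\<Sum>x\<in>A. of_nat (c x) * x) - a \<in> S"
proof -
  have "(\<Sum>x\<in>A. of_nat (c x) * x) - a = of_nat (c a) * a - a + (\<Sum>x\<in>A - {a}. of_nat (c x) * x)"
    by (simp only: sum.remove[OF finite_gen assms(1)] algebra_simps)
  also have "of_nat (c a) * a - a = of_nat (c a - 1) * a"
    using assms(2) by (cases "c a") (simp_all add: algebra_simps)
  also have "\<dots> + (\<Sum>x\<in>A - {a}. of_nat (c x) * x) = (\<Sum>x\<in>A. of_nat ((c(a := c a - 1)) x) * x)"
    by (subst sum.remove[OF finite_gen assms(1)]) (auto intro!: sum.cong)
  finally have "(\<Sum>x\<in>A. of_nat (c x) * x) - a = (\<Sum>x\<in>A. of_nat ((c(a := c a - 1)) x) * x)" .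
  then show ?thesis using gen_sum[OF gen_subset] by simp
qed

definition face :: "'g set \<Rightarrow> bool" where
  "face F \<longleftrightarrow> F \<subseteq> S \<and> 0 \<in> F \<and> (\<forall>a\<in>F. \<forall>b\<in>F. a + b \<in> F) \<and>
    (\<forall>a\<in>S. \<forall>b\<in>S. a + b \<in> F \<longrightarrow> a \<in> F)"

lemma face_add: "face F \<Longrightarrow> a \<in> F \<Longrightarrow> b \<in> F \<Longrightarrow> a + b \<in> F"
  and face_zero: "face F \<Longrightarrow> 0 \<in> F"
  and face_subset: "face F \<Longrightarrow> F \<subseteq> S"
  and face_dest: "face F \<Longrightarrow> a \<in> S \<Longrightarrow> b \<in> S \<Longrightarrow> a + b \<in> F \<Longrightarrow> a \<in> F"
  unfolding face_def by blast+

lemma face_mult: "face F \<Longrightarrow> a \<in> F \<Longrightarrow> of_nat k * a \<in> F"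
  by (rule submonoid_mult) (auto intro: face_add face_zero)

lemma face_mult_dest:
  assumes "face F" "a \<in> S" "k > 0" "of_nat k * a \<in> F"
  shows "a \<in> F"
proof -
  obtain l where "k = Suc l" using assms(3) gr0_conv_Suc by blast
  then have "a + of_nat l * a \<in> F" using assms(4) by (simp add: algebra_simps)
  then show ?thesis using face_dest[OF assms(1,2) mult[OF assms(2)]] by blast
qed

lemma face_coeffs:
  assumes "face F" "(\<Sum>x\<in>A. of_nat (c x) * x) \<in> F" "a \<in> A" "c a > 0"
  shows "a \<in> F"
proof -
  have "a + ((\<Sum>x\<in>A. of_nat (c x) * x) - a) \<in> F" using assms(2) by simp
  then show ?thesis
    using face_dest[OF assms(1), of a] split_generator[of a c, OF assms(3,4)] gen_subset assms(3) by blast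
qed

lemma face_generated:
  assumes "face F" "m \<in> F"
  shows "\<exists>c. m = (\<Sum>a\<in>A \<inter> F. of_nat (c a) * a)"
proof -
  obtain c where c: "m = (\<Sum>a\<in>A. of_nat (c a) * a)"
    using generated assms face_subset by blast
  have "of_nat (c a) * a = 0" if "a \<in> A - A \<inter> F" for a
    using face_coeffs[OF assms(1), of c a] assms(2) that c by (cases "c a") auto
  then have "m = (\<Sum>a\<in>A \<inter> F. of_nat (c a) * a)"
    unfolding c using finite_gen by (intro sum.mono_neutral_right) auto
  then show ?thesis by blast
qed

text \<open>
  So there are only finitely many faces, and maximal proper faces exist.
\<close>

lemma face_determined:
  assumes "face F" "face F'" "A \<inter> F' \<subseteq> F"
  shows "F' \<subseteq> F"
proof
  fix m assume "m \<in> F'"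
  then obtain c where "m = (\<Sum>a\<in>A \<inter> F'. of_nat (c a) * a)" using face_generated assms(2) by blast
  moreover have "(\<Sum>a\<in>A \<inter> F'. of_nat (c a) * a) \<in> F"
    using assms by (intro submonoid_sum) (auto intro: face_add face_zero face_mult)
  ultimately show "m \<in> F" by simp
qed

lemma maximal_face:
  assumes "S \<noteq> {0}"
  obtains F where "face F" "F \<noteq> S" "\<And>F'. face F' \<Longrightarrow> F \<subseteq> F' \<Longrightarrow> F' \<noteq> S \<Longrightarrow> F' = F"
proof -
  define P where "P F \<longleftrightarrow> face F \<and> F \<noteq> S" for F
  have "a = 0" if "a \<in> S" "b \<in> S" "a + b = 0" for a b
    using pointed[OF that(1)] that(2,3) by (metis add_eq_0_iff)
  then have "P {0}" using assms zero unfolding P_def face_def by auto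
  moreover have "\<forall>F. P F \<longrightarrow> card (A \<inter> F) < Suc (card A)"
    using card_mono[OF finite_gen] by (simp add: less_Suc_eq_le)
  ultimately obtain F where F: "P F" "\<And>F'. P F' \<Longrightarrow> card (A \<inter> F') \<le> card (A \<inter> F)"
    using ex_has_greatest_nat[of P "{0}" "\<lambda>F. card (A \<inter> F)"] by blast
  show ?thesis
  proof (rule that)
    fix F' assume F': "face F'" "F \<subseteq> F'" "F' \<noteq> S"
    have "A \<inter> F = A \<inter> F'"
      using F(2)[of F'] F' finite_gen by (intro card_seteq) (auto simp: P_def)
    then show "F' = F" using face_determined[of F F'] F F' unfolding P_def by auto
  qed (use F in \<open>auto simp: P_def\<close>)
qed

end

locale facet = fg_monoid S A for S A :: "'g::comm_ring_1 set" +
  fixes F :: "'g set"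
  assumes face: "face F"
    and proper: "F \<noteq> S"
    and maximal: "face F' \<Longrightarrow> F \<subseteq> F' \<Longrightarrow> F' \<noteq> S \<Longrightarrow> F' = F"
begin

lemmas in_S = subsetD[OF face_subset[OF face]]
lemmas F_add = face_add[OF face]
lemmas F_mult = face_mult[OF face]
lemmas F_zero = face_zero[OF face]

text \<open>
  The elements bounded above by some \<open>k c + f\<close> with \<open>f \<in> F\<close>, in the order \<open>x \<le> x + y\<close> for \<open>y \<in> S\<close>, form
  a face that contains \<open>F\<close> and \<open>c\<close>. As \<open>F\<close> is maximal, every element of \<open>S\<close> is bounded in this way.
\<close>

lemma archimedean:
  assumes "c \<in> S" "c \<notin> F" "b \<in> S"
  shows "\<exists>k. \<exists>f\<in>F. \<exists>y\<in>S. b + y = of_nat k * c + f"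
proof -
  define F' where "F' = {x \<in> S. \<exists>k. \<exists>f\<in>F. \<exists>y\<in>S. x + y = of_nat k * c + f}"
  have "face F'"
    unfolding face_def
  proof (intro conjI ballI impI)
    show "F' \<subseteq> S" unfolding F'_def by blast
    have "0 + 0 = of_nat 0 * c + 0" by simp
    then show "0 \<in> F'" using zero F_zero unfolding F'_def by blast
  next
    fix a b assume "a \<in> F'" "b \<in> F'"
    then obtain k f y k' f' y' where *: "a \<in> S" "b \<in> S" "f \<in> F" "f' \<in> F" "y \<in> S" "y' \<in> S"
      "a + y = of_nat k * c + f" "b + y' = of_nat k' * c + f'"
      unfolding F'_def by blast
    have "(a + b) + (y + y') = (a + y) + (b + y')" by simp
    also have "\<dots> = of_nat (k + k') * c + (f + f')" unfolding * by (simp add: algebra_simps)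
    finally show "a + b \<in> F'" using * add F_add unfolding F'_def by blast
  next
    fix a b assume ab: "a \<in> S" "b \<in> S" "a + b \<in> F'"
    then obtain k f y where *: "f \<in> F" "y \<in> S" "a + b + y = of_nat k * c + f"
      unfolding F'_def by blast
    then have "a + (b + y) = of_nat k * c + f" by (simp add: algebra_simps)
    then show "a \<in> F'" using * ab add unfolding F'_def by blast
  qed
  moreover have "x \<in> F'" if "x \<in> F" for x
  proof -
    have "x + 0 = of_nat 0 * c + x" by simp
    then show ?thesis using zero that in_S unfolding F'_def by blast
  qed
  moreover have "c + 0 = of_nat 1 * c + 0" by simp
  then have "c \<in> F'" using assms zero F_zero unfolding F'_def by blast
  ultimately have "F' = S" using maximal assms(2) by blast
  then show ?thesis using assms(3) unfolding F'_def by blast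
qed

text \<open>
  The group generated by \<open>F\<close>. Working modulo \<open>L\<close> replaces passing to the quotient.
\<close>

definition L :: "'g set" where
  "L = {f - f' | f f'. f \<in> F \<and> f' \<in> F}"

lemma L_diffI: "f \<in> F \<Longrightarrow> f' \<in> F \<Longrightarrow> f - f' \<in> L"
  unfolding L_def by blast

lemma F_subset_L: "f \<in> F \<Longrightarrow> f \<in> L"
  using L_diffI[of f 0] F_zero by simp

lemma L_minus: "l \<in> L \<Longrightarrow> - l \<in> L"
  unfolding L_def by (auto) (metis minus_diff_eq)

lemma L_add: "l \<in> L \<Longrightarrow> l' \<in> L \<Longrightarrow> l + l' \<in> L"
proof -
  assume "l \<in> L" "l' \<in> L"
  then obtain f g f' g' where *: "l = f - g" "l' = f' - g'" "f \<in> F" "g \<in> F" "f' \<in> F" "g' \<in> F"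
    unfolding L_def by blast
  have "l + l' = (f + f') - (g + g')" unfolding * by simp
  then show ?thesis using * L_diffI F_add by metis
qed

lemma L_diff: "l \<in> L \<Longrightarrow> l' \<in> L \<Longrightarrow> l - l' \<in> L"
  using L_add[of l "- l'"] L_minus by simp

lemma L_mult: "l \<in> L \<Longrightarrow> of_nat k * l \<in> L"
  by (rule submonoid_mult) (auto intro: L_add F_subset_L F_zero)

lemma L_Int_S: "l \<in> L \<Longrightarrow> l \<in> S \<Longrightarrow> l \<in> F"
proof -
  assume "l \<in> L" "l \<in> S"
  then obtain f g where *: "l = f - g" "f \<in> F" "g \<in> F" unfolding L_def by blast
  then have "l + g \<in> F" by simp
  then show ?thesis using face_dest[OF face] \<open>l \<in> S\<close> * in_S by blast
qed

text \<open>
  Modulo \<open>L\<close>, the monoid has rank one. Consider all solutions of \<open>i c + f = j b + y\<close> with \<open>f \<in> F\<close> and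
  \<open>y \<in> S\<close>, and choose one where \<open>j / i\<close> is maximal: geometrically, one leaves \<open>S\<close> along the segment from
  \<open>c\<close> in direction \<open>- b\<close>. The maximum exists because, by Dickson's lemma, the solutions are sums of
  finitely many minimal ones. At the maximum \<open>y\<close> lies in \<open>F\<close>, as otherwise a multiple of \<open>y\<close> dominates \<open>b\<close>
  by \<open>archimedean\<close>, and another \<open>b\<close> could be split off.
\<close>

lemma commensurable:
  assumes c: "c \<in> S" "c \<notin> F" and b: "b \<in> S" "b \<notin> F"
  shows "\<exists>i j. i > 0 \<and> of_nat i * b - of_nat j * c \<in> L"
proof -
  let ?i = "Inl True :: bool + 'g + 'g" and ?j = "Inl False :: bool + 'g + 'g"
  \<comment> \<open>A solution is encoded by its vector of natural coordinates: \<open>i\<close>, \<open>j\<close>, and the coefficients of \<open>f\<close> and \<open>y\<close> over the generators.\<close>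
  define f where "f v = (\<Sum>a\<in>A \<inter> F. of_nat (v (Inr (Inl a))) * a)" for v :: "bool + 'g + 'g \<Rightarrow> nat"
  define y where "y v = (\<Sum>a\<in>A. of_nat (v (Inr (Inr a))) * a)" for v :: "bool + 'g + 'g \<Rightarrow> nat"
  define E where "E v \<longleftrightarrow> of_nat (v ?i) * c + f v = of_nat (v ?j) * b + y v" for v
  define J where "J = {?i, ?j} \<union> Inr ` (Inl ` A \<union> Inr ` A)"
  have fF: "f v \<in> F" for v
    unfolding f_def by (rule submonoid_sum) (auto intro: F_add F_zero F_mult)
  have yS: "y v \<in> S" for v
    unfolding y_def by (rule gen_sum[OF gen_subset])
  have EI: "\<exists>v. E v \<and> v ?i = i \<and> v ?j = j"
    if "f0 \<in> F" "y0 \<in> S" "of_nat i * c + f0 = of_nat j * b + y0" for i j f0 y0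
  proof -
    obtain d where d: "f0 = (\<Sum>a\<in>A \<inter> F. of_nat (d a) * a)"
      using face_generated[OF face \<open>f0 \<in> F\<close>] by blast
    obtain e where e: "y0 = (\<Sum>a\<in>A. of_nat (e a) * a)" using generated[OF \<open>y0 \<in> S\<close>] by blast
    define v where "v = (\<lambda>z. case z of Inl True \<Rightarrow> i | Inl False \<Rightarrow> j | Inr (Inl a) \<Rightarrow> d a | Inr (Inr a) \<Rightarrow> e a)"
    have "E v" "v ?i = i" "v ?j = j"
      using that(3) unfolding E_def f_def y_def v_def d e by simp_all
    then show ?thesis by blast
  qed
  have E_diff: "E (\<lambda>z. v z - u z)" if "E v" "E u" "\<And>z. z \<in> J \<Longrightarrow> u z \<le> v z" for u v
  proof -
    have f: "f (\<lambda>z. v z - u z) = f v - f u"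
      unfolding f_def sum_subtractf[symmetric]
      by (rule sum.cong) (auto simp: J_def of_nat_diff that(3) algebra_simps)
    have y: "y (\<lambda>z. v z - u z) = y v - y u"
      unfolding y_def sum_subtractf[symmetric]
      by (rule sum.cong) (auto simp: J_def of_nat_diff that(3) algebra_simps)
    have le: "u ?i \<le> v ?i" "u ?j \<le> v ?j" using that(3) by (auto simp: J_def)
    have "of_nat (v ?i - u ?i) * c + f (\<lambda>z. v z - u z)
      = (of_nat (v ?i) * c + f v) - (of_nat (u ?i) * c + f u)"
      using le by (simp add: f of_nat_diff algebra_simps)
    also have "\<dots> = (of_nat (v ?j) * b + y v) - (of_nat (u ?j) * b + y u)"
      using that(1,2) unfolding E_def by simp
    also have "\<dots> = of_nat (v ?j - u ?j) * b + y (\<lambda>z. v z - u z)"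
      using le by (simp add: y of_nat_diff algebra_simps)
    finally show ?thesis unfolding E_def .
  qed
  have pos: "v ?j = 0" if "E v" "v ?i = 0" for v
  proof (rule ccontr)
    assume j: "v ?j \<noteq> 0"
    have "of_nat (v ?j) * b + y v \<in> F" using that fF[of v] unfolding E_def by simp
    then have "of_nat (v ?j) * b \<in> F" using face_dest[OF face mult[OF b(1)] yS] by blast
    then show False using face_mult_dest[OF face b(1)] j b(2) by blast
  qed
  define V where "V = {v. E v \<and> v ?i > 0}"
  obtain B where B: "finite B" "B \<subseteq> V" "\<And>v. v \<in> V \<Longrightarrow> \<exists>u\<in>B. \<forall>z\<in>J. u z \<le> v z"
    using dickson[of J V "\<lambda>v. v"] finite_gen unfolding J_def by auto
  obtain k f0 y0 where "f0 \<in> F" "y0 \<in> S" "b + y0 = of_nat k * c + f0"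
    using archimedean[OF c b(1)] by blast
  then obtain v0 where v0: "E v0" "v0 ?i = k" "v0 ?j = 1"
    using EI[of f0 y0 k 1] by auto
  then have "v0 \<in> V" using pos unfolding V_def by force
  then have "B \<noteq> {}" using B by blast
  define \<rho> where "\<rho> v = real (v ?j) / real (v ?i)" for v :: "bool + 'g + 'g \<Rightarrow> nat"
  have "Max (\<rho> ` B) \<in> \<rho> ` B" using B(1) \<open>B \<noteq> {}\<close> by simp
  then obtain w where w: "w \<in> B" "\<rho> w = Max (\<rho> ` B)" by auto
  have wV: "E w" "w ?i > 0" using w B unfolding V_def by auto
  have max: "real (v ?j) \<le> \<rho> w * real (v ?i)" if "E v" for v
    using that
  proof (induction "v ?i" arbitrary: v rule: less_induct)
    case (less v)
    show ?case
    proof (cases "v ?i = 0")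
      case True
      then show ?thesis using pos less by simp
    next
      case False
      then obtain u where u: "u \<in> B" "\<And>z. z \<in> J \<Longrightarrow> u z \<le> v z"
        using B(3)[of v] less.prems unfolding V_def by auto
      have uV: "E u" "u ?i > 0" using u(1) B unfolding V_def by auto
      have le: "u ?i \<le> v ?i" "u ?j \<le> v ?j" using u(2) by (auto simp: J_def)
      have "E (\<lambda>z. v z - u z)" using E_diff uV(1) less.prems u(2) by blast
      then have "real (v ?j - u ?j) \<le> \<rho> w * real (v ?i - u ?i)"
        using less.hyps[of "\<lambda>z. v z - u z"] False uV(2) by simp
      moreover have "\<rho> u \<le> \<rho> w" using u(1) w B(1) by simp
      then have "real (u ?j) \<le> \<rho> w * real (u ?i)" using uV(2) unfolding \<rho>_def by (simp add: field_simps)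
      ultimately show ?thesis using le by (simp add: of_nat_diff algebra_simps)
    qed
  qed
  have "y w \<in> F"
  proof (rule ccontr)
    assume "y w \<notin> F"
    then obtain l f' y' where *: "f' \<in> F" "y' \<in> S" "b + y' = of_nat l * y w + f'"
      using archimedean[OF yS _ b(1)] by blast
    have "of_nat (l * w ?i) * c + (of_nat l * f w + f') = of_nat l * (of_nat (w ?i) * c + f w) + f'"
      by (simp add: algebra_simps)
    also have "\<dots> = of_nat l * of_nat (w ?j) * b + (of_nat l * y w + f')"
      using wV(1) unfolding E_def by (simp add: algebra_simps)
    also have "\<dots> = of_nat (l * w ?j + 1) * b + y'"
      unfolding *(3)[symmetric] by (simp add: algebra_simps)
    finally obtain v where v: "E v" "v ?i = l * w ?i" "v ?j = l * w ?j + 1"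
      using EI *(1,2) F_add F_mult fF by blast
    then have "real (l * w ?j + 1) \<le> \<rho> w * real (l * w ?i)" using max[OF v(1)] by simp
    then show False using wV(2) unfolding \<rho>_def by (simp add: field_simps)
  qed
  have "w ?j > 0"
  proof (rule ccontr)
    assume "\<not> w ?j > 0"
    then show False using max[OF v0(1)] v0 unfolding \<rho>_def by simp
  qed
  moreover have "of_nat (w ?j) * b - of_nat (w ?i) * c = f w - y w"
    using wV(1) unfolding E_def by (simp add: algebra_simps)
  then have "of_nat (w ?j) * b - of_nat (w ?i) * c \<in> L"
    using L_diffI[OF fF \<open>y w \<in> F\<close>] by simp
  ultimately show ?thesis by blast
qed

text \<open>
  Multiplying the denominators that belong to the finitely many generators gives one that works for
  all of \<open>S\<close>, so that numerators become additive.
\<close>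

lemma common_denominator:
  assumes c: "c \<in> S" "c \<notin> F"
  obtains N where "N > 0" "\<And>m. m \<in> S \<Longrightarrow> \<exists>j. of_nat N * m - of_nat j * c \<in> L"
proof -
  have "\<exists>i j. i > 0 \<and> of_nat i * a - of_nat j * c \<in> L" if "a \<in> A" for a
  proof (cases "a \<in> F")
    case True
    then have "of_nat 1 * a - of_nat 0 * c \<in> L" using F_subset_L by simp
    then show ?thesis using zero_less_one by blast
  next
    case False
    then show ?thesis using commensurable[OF c _ False] that gen_subset by blast
  qed
  then obtain I J where IJ: "\<And>a. a \<in> A \<Longrightarrow> I a > 0" "\<And>a. a \<in> A \<Longrightarrow> of_nat (I a) * a - of_nat (J a) * c \<in> L"
    by metis
  define N where "N = (\<Prod>a\<in>A. I a)"
  have "N > 0" using IJ(1) unfolding N_def by (simp add: prod_pos)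
  moreover have "\<exists>j. of_nat N * m - of_nat j * c \<in> L" if "m \<in> S" for m
  proof -
    obtain d where d: "m = (\<Sum>a\<in>A. of_nat (d a) * a)" using generated[OF \<open>m \<in> S\<close>] by blast
    define q where "q a = d a * (N div I a)" for a
    have N: "of_nat N = of_nat (N div I a) * (of_nat (I a) :: 'g)" if "a \<in> A" for a
    proof -
      have "I a dvd N" unfolding N_def using finite_gen that by (rule dvd_prodI)
      then have "N = N div I a * I a" by simp
      then show ?thesis by (metis of_nat_mult)
    qed
    have "of_nat N * m - of_nat (\<Sum>a\<in>A. q a * J a) * c
        = (\<Sum>a\<in>A. of_nat (q a) * (of_nat (I a) * a - of_nat (J a) * c))"
      unfolding d by (simp add: sum_distrib_left sum_distrib_right sum_subtractf[symmetric] N q_def algebra_simps)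
    moreover have "\<dots> \<in> L"
      using IJ(2) by (intro submonoid_sum L_mult) (auto intro: L_add F_subset_L F_zero)
    ultimately show ?thesis by metis
  qed
  ultimately show ?thesis by (rule that)
qed

text \<open>
  The height is the numerator over a common denominator, divided by the generator \<open>g\<close> of the group of
  its differences. Saturation shows that every difference of elements of \<open>S\<close> with nonnegative height
  lies in \<open>S\<close> after adding an element of \<open>F\<close>. Therefore a difference \<open>e1 - e2\<close> of height \<open>-1\<close> becomes a
  root once enough elements of \<open>F\<close> are added to it to serve all generators of positive height.
\<close>

lemma demazure_root:
  "\<exists>(p :: 'g \<Rightarrow> nat) e. (\<forall>a\<in>S. \<forall>b\<in>S. p (a + b) = p a + p b) \<and>
    (\<forall>m\<in>S. p m > 0 \<longrightarrow> m + e \<in> S \<and> p m = Suc (p (m + e))) \<and> (\<exists>m\<in>S. p m > 0)"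
proof -
  obtain c where c: "c \<in> S" "c \<notin> F" using proper in_S by blast
  obtain N where N: "N > 0" "\<And>m. m \<in> S \<Longrightarrow> \<exists>j. of_nat N * m - of_nat j * c \<in> L"
    using common_denominator[OF c] by blast
  have c_free: "k = 0" if "of_nat k * c \<in> L" for k
    using face_mult_dest[OF face c(1)] L_Int_S[OF that mult[OF c(1)]] c(2) by blast
  have unique: "j = j'" if "of_nat N * m - of_nat j * c \<in> L" "of_nat N * m - of_nat j' * c \<in> L" for m j j'
    using that
  proof (induction j j' rule: linorder_wlog)
    case (le j j')
    have "of_nat (j' - j) * c = (of_nat N * m - of_nat j * c) - (of_nat N * m - of_nat j' * c)"
      using le(1) by (simp add: of_nat_diff algebra_simps)
    then have "of_nat (j' - j) * c \<in> L" using L_diff[OF le(2,3)] by (simp only:)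
    then show ?case using c_free[of "j' - j"] le(1) by simp
  qed auto
  define q where "q m = (THE j. of_nat N * m - of_nat j * c \<in> L)" for m
  have qI: "q m = j" if "of_nat N * m - of_nat j * c \<in> L" for m j
    unfolding q_def using that unique by blast
  have q: "of_nat N * m - of_nat (q m) * c \<in> L" if "m \<in> S" for m
    using N(2)[OF that] qI by blast
  have q_add: "q (a + b) = q a + q b" if "a \<in> S" "b \<in> S" for a b
    by (rule qI) (use L_add[OF q[OF that(1)] q[OF that(2)]] in \<open>simp add: algebra_simps\<close>)
  have q0: "q 0 = 0" using q_add[OF zero zero] by simp
  have q_mult: "q (of_nat k * a) = k * q a" if "a \<in> S" for k a
    using that by (induction k) (auto simp: q0 q_add mult distrib_right)
  have qF: "q f = 0" if "f \<in> F" for f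
    by (rule qI) (use F_subset_L[OF F_mult[OF that, of N]] in simp)
  have qc: "q c = N" by (rule qI) (use F_subset_L[OF F_zero] in simp)
  \<comment> \<open>The half space of nonnegative height is \<open>S + L\<close>.\<close>
  have localization: "\<exists>f\<in>F. a - b + f \<in> S" if ab: "a \<in> S" "b \<in> S" "q b \<le> q a" for a b
  proof -
    have "(of_nat N * a - of_nat (q a) * c) - (of_nat N * b - of_nat (q b) * c) \<in> L"
      using ab q L_diff by blast
    then obtain f g where fg: "f \<in> F" "g \<in> F"
      "(of_nat N * a - of_nat (q a) * c) - (of_nat N * b - of_nat (q b) * c) = f - g"
      unfolding L_def by blast
    obtain N' where N': "N = Suc N'" using N(1) gr0_conv_Suc by blast
    have "of_nat N * (a + g - b) = of_nat (q a - q b) * c + f + of_nat N' * g"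
    proof -
      have "of_nat N * (a + g - b)
        = (of_nat N * a - of_nat (q a) * c) - (of_nat N * b - of_nat (q b) * c)
          + of_nat (q a) * c - of_nat (q b) * c + of_nat N * g" by (simp add: algebra_simps)
      also have "\<dots> = f - g + of_nat (q a) * c - of_nat (q b) * c + of_nat N * g"
        unfolding fg(3) ..
      also have "\<dots> = of_nat (q a - q b) * c + f + of_nat N' * g"
        using ab(3) by (simp add: N' of_nat_diff algebra_simps)
      finally show ?thesis .
    qed
    moreover have "of_nat (q a - q b) * c + f + of_nat N' * g \<in> S"
      using fg c(1) by (intro add mult) (auto intro: in_S)
    ultimately have "a + g - b \<in> S"
      using saturated[of "a + g" b N] ab fg N(1) add in_S by metis
    then show ?thesis using fg(2) by (intro bexI[of _ g]) (auto simp: algebra_simps)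
  qed
  define Q where "Q d \<longleftrightarrow> d > 0 \<and> (\<exists>a\<in>S. \<exists>b\<in>S. q a = q b + d)" for d
  define g where "g = (LEAST d. Q d)"
  have "Q N" unfolding Q_def using N(1) c(1) zero qc q0 by (intro conjI bexI[of _ c] bexI[of _ 0]) auto
  then have "Q g" unfolding g_def by (rule LeastI)
  then obtain e1 e2 where e: "g > 0" "e1 \<in> S" "e2 \<in> S" "q e2 = q e1 + g" unfolding Q_def by blast
  have g_dvd: "g dvd q m" if "m \<in> S" for m
  proof (rule ccontr)
    assume "\<not> g dvd q m"
    then have "q m mod g > 0" by (simp add: mod_greater_zero_iff_not_dvd)
    moreover have "q (m + of_nat (q m div g) * e1) = q (of_nat (q m div g) * e2) + q m mod g"
      using that e by (simp add: q_add q_mult mult distrib_left)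
    moreover have "m + of_nat (q m div g) * e1 \<in> S" "of_nat (q m div g) * e2 \<in> S"
      using that e by (auto intro: add mult)
    ultimately have "Q (q m mod g)" unfolding Q_def by blast
    then have "g \<le> q m mod g" unfolding g_def by (rule Least_le)
    then show False using mod_less_divisor[OF e(1), of "q m"] by simp
  qed
  define p where "p m = q m div g" for m
  have qp: "q m = p m * g" if "m \<in> S" for m using g_dvd[OF that] unfolding p_def by simp
  have p_add: "p (a + b) = p a + p b" if "a \<in> S" "b \<in> S" for a b
    using q_add[OF that] g_dvd that unfolding p_def by simp
  have p0: "p 0 = 0" using q0 unfolding p_def by simp
  have p_mult: "p (of_nat k * a) = k * p a" if "a \<in> S" for k a
    using that by (induction k) (auto simp: p0 p_add mult distrib_right)
  \<comment> \<open>Positive height is at least \<open>1\<close>, which compensates the height \<open>-1\<close> of \<open>e1 - e2\<close>.\<close>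
  have "\<exists>f. f \<in> F \<and> a + e1 - e2 + f \<in> S" if "a \<in> A" "p a > 0" for a
  proof -
    have a: "a \<in> S" using that gen_subset by blast
    then have "q e2 \<le> q (a + e1)" using that qp[of a] e by (simp add: q_add)
    then show ?thesis using localization[of "a + e1" e2] a e add by blast
  qed
  then obtain f where f: "\<And>a. a \<in> A \<Longrightarrow> p a > 0 \<Longrightarrow> f a \<in> F"
    "\<And>a. a \<in> A \<Longrightarrow> p a > 0 \<Longrightarrow> a + e1 - e2 + f a \<in> S" by metis
  define A' where "A' = {a \<in> A. p a > 0}"
  have finA': "finite A'" unfolding A'_def using finite_gen by simp
  define e where "e = e1 - e2 + sum f A'"
  have sumF: "sum f B \<in> F" if "B \<subseteq> A'" for B
    using that f(1) by (intro submonoid_sum) (auto intro: F_zero F_add simp: A'_def)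
  have root: "m + e \<in> S \<and> p m = Suc (p (m + e))" if m: "m \<in> S" "p m > 0" for m
  proof -
    obtain d where d: "m = (\<Sum>a\<in>A. of_nat (d a) * a)" using generated[OF m(1)] by blast
    have "\<exists>a\<in>A. d a > 0 \<and> p a > 0"
    proof (rule ccontr)
      assume *: "\<not> ?thesis"
      have pA: "p (of_nat (d a) * a) = 0" if "a \<in> A" for a
        using * that subsetD[OF gen_subset that] p_mult[of a "d a"] by auto
      have "p (\<Sum>a\<in>B. of_nat (d a) * a) = 0 \<and> (\<Sum>a\<in>B. of_nat (d a) * a) \<in> S" if "B \<subseteq> A" for B
        using finite_subset[OF that finite_gen] that
      proof (induction B rule: finite_induct)
        case (insert x B)
        then show ?case using gen_subset by (auto simp: p_add pA add mult subset_eq)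
      qed (auto simp: p0 zero)
      then show False using m(2) d by auto
    qed
    then obtain a where a: "a \<in> A" "d a > 0" "p a > 0" by blast
    have a': "a \<in> A'" using a unfolding A'_def by simp
    have "m + e = (a + e1 - e2 + f a) + sum f (A' - {a}) + (m - a)"
      unfolding e_def sum.remove[OF finA' a'] by (simp add: algebra_simps)
    moreover have "m - a \<in> S" using split_generator[of a d, OF a(1,2)] d by simp
    moreover have "sum f (A' - {a}) \<in> S" by (intro in_S sumF) blast
    ultimately have me: "m + e \<in> S" using f(2)[OF a(1,3)] add by metis
    have "(m + e) + e2 = m + e1 + sum f A'" unfolding e_def by (simp add: algebra_simps)
    then have "p (m + e) + p e2 = p m + p e1 + p (sum f A')"
      using me m(1) e sumF[of A'] by (metis add in_S order_refl p_add)
    moreover have "p (sum f A') = 0" using sumF[of A'] qF unfolding p_def by simp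
    moreover have "p e2 = Suc (p e1)" using e g_dvd[of e1] unfolding p_def by simp
    ultimately show ?thesis using me by simp
  qed
  moreover have "p c > 0" using qp[OF c(1)] qc N(1) by (cases "p c") auto
  ultimately show ?thesis using p_add c(1) by (intro exI[of _ p] exI[of _ e]) blast
qed

end

context fg_monoid
begin

text \<open>
  If \<open>0\<close> is the only element of height \<open>0\<close>, adding the root repeatedly leads from any \<open>m\<close> to
  \<open>0\<close>, so \<open>m\<close> is a multiple of \<open>- e\<close>.
\<close>

theorem ray_or_root:
  "(\<exists>u\<in>S. \<forall>m\<in>S. \<exists>k. m = of_nat k * u) \<or>
   (\<exists>(p :: 'g \<Rightarrow> nat) e w m0. (\<forall>a\<in>S. \<forall>b\<in>S. p (a + b) = p a + p b) \<and>
    (\<forall>m\<in>S. p m > 0 \<longrightarrow> m + e \<in> S \<and> p m = Suc (p (m + e))) \<and>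
    w \<in> S \<and> w \<noteq> 0 \<and> p w = 0 \<and> m0 \<in> S \<and> p m0 > 0)"
proof (cases "S = {0}")
  case True
  then show ?thesis by auto
next
  case False
  then obtain F where "face F" "F \<noteq> S" "\<And>F'. face F' \<Longrightarrow> F \<subseteq> F' \<Longrightarrow> F' \<noteq> S \<Longrightarrow> F' = F"
    using maximal_face by blast
  then interpret facet S A F by unfold_locales
  obtain p e m0 where p: "\<And>a b. a \<in> S \<Longrightarrow> b \<in> S \<Longrightarrow> p (a + b) = p a + (p b :: nat)"
    "\<And>m. m \<in> S \<Longrightarrow> p m > 0 \<Longrightarrow> m + e \<in> S \<and> p m = Suc (p (m + e))" "m0 \<in> S" "p m0 > 0"
    using demazure_root by blast
  show ?thesis
  proof (cases "\<exists>w\<in>S. w \<noteq> 0 \<and> p w = 0")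
    case True
    then show ?thesis using p by blast
  next
    case False
    have mult_e: "m = of_nat (p m) * (- e)" if "m \<in> S" for m
    proof -
      have "m + of_nat (p m) * e = 0" using root_descent[OF p(2) that order_refl] False by auto
      then show ?thesis by (simp add: eq_neg_iff_add_eq_0)
    qed
    obtain k where k: "p m0 = Suc k" using p(4) gr0_conv_Suc by blast
    have "m0 + of_nat k * e = - e" using mult_e[OF p(3)] k by (simp add: algebra_simps)
    then have "- e \<in> S" using root_descent[OF p(2,3), of k] k by simp
    then show ?thesis using mult_e by blast
  qed
qed

end

section \<open>Polynomial functions and linear combinations of characters\<close>

lemma poly_functions_sum:
  "(\<And>i. i \<in> I \<Longrightarrow> f i \<in> poly_functions n) \<Longrightarrow> (\<lambda>x. \<Sum>i\<in>I. f i x) \<in> poly_functions n"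
  by (induction I rule: infinite_finite_induct) (auto intro: poly_functions.const poly_functions.add)

lemma poly_functions_scale: "f \<in> poly_functions n \<Longrightarrow> (\<lambda>x. c * f x) \<in> poly_functions n"
  by (intro poly_functions.mult poly_functions.const)

lemma poly_functions_diff:
  assumes "f \<in> poly_functions n" "g \<in> poly_functions n"
  shows "(\<lambda>x. f x - g x) \<in> poly_functions n"
  using poly_functions.add[OF assms(1) poly_functions_scale[OF assms(2), of "-1"]] by simp

lemma poly_functions_power: "f \<in> poly_functions n \<Longrightarrow> (\<lambda>x. f x ^ k) \<in> poly_functions n"
  by (induction k) (auto intro: poly_functions.const poly_functions.mult)

lemma poly_functions_prod:
  "(\<And>i. i \<in> I \<Longrightarrow> f i \<in> poly_functions n) \<Longrightarrow> (\<lambda>x. \<Prod>i\<in>I. f i x) \<in> poly_functions n"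
  by (induction I rule: infinite_finite_induct) (auto intro: poly_functions.const poly_functions.mult)

lemma poly_functions_compose:
  assumes "p \<in> poly_functions n" "\<And>i. i < n \<Longrightarrow> q i \<in> poly_functions k"
  shows "(\<lambda>z. p (map (\<lambda>i. q i z) [0..<n])) \<in> poly_functions k"
  using assms(1)
proof induction
  case (coordinate i)
  then show ?case using assms(2) by simp
qed (auto intro: poly_functions.intros)

text \<open>
  The functions \<open>ev a\<close> for \<open>a \<in> E\<close> stand for a family of monomials on \<open>Y\<close>; the parameter \<open>ev\<close> covers
  characters of the torus, their extensions to \<open>X\<close>, and products of functions in separate variables.
\<close>

definition combination :: "('j \<Rightarrow> 'y \<Rightarrow> 'k::comm_ring_1) \<Rightarrow> 'j set \<Rightarrow> 'y set \<Rightarrow> ('y \<Rightarrow> 'k) \<Rightarrow> bool" where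
  "combination ev E Y f \<longleftrightarrow>
    (\<exists>A c. finite A \<and> A \<subseteq> E \<and> (\<forall>y\<in>Y. f y = (\<Sum>a\<in>A. c a * ev a y)))"

lemma combination_indexed:
  assumes "finite I" "\<And>i. i \<in> I \<Longrightarrow> m i \<in> E" "\<And>y. y \<in> Y \<Longrightarrow> f y = (\<Sum>i\<in>I. d i * ev (m i) y)"
  shows "combination ev E Y f"
  unfolding combination_def
proof (intro exI conjI ballI)
  show "f y = (\<Sum>a\<in>m ` I. (\<Sum>i\<in>{i \<in> I. m i = a}. d i) * ev a y)" if "y \<in> Y" for y
  proof -
    have "f y = (\<Sum>a\<in>m ` I. \<Sum>i\<in>{i \<in> I. m i = a}. d i * ev (m i) y)"
      unfolding assms(3)[OF that] by (rule sum.image_gen[OF assms(1)])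
    also have "\<dots> = (\<Sum>a\<in>m ` I. (\<Sum>i\<in>{i \<in> I. m i = a}. d i) * ev a y)"
      by (intro sum.cong refl) (simp add: sum_distrib_right)
    finally show ?thesis .
  qed
qed (use assms in auto)

lemma combination_add:
  assumes "combination ev E Y f" "combination ev E Y g"
  shows "combination ev E Y (\<lambda>y. f y + g y)"
proof -
  obtain A c B d where *: "finite A" "A \<subseteq> E" "\<And>y. y \<in> Y \<Longrightarrow> f y = (\<Sum>a\<in>A. c a * ev a y)"
    "finite B" "B \<subseteq> E" "\<And>y. y \<in> Y \<Longrightarrow> g y = (\<Sum>b\<in>B. d b * ev b y)"
    using assms unfolding combination_def by metis
  show ?thesis
  proof (rule combination_indexed)
    show "finite (A <+> B)" using * by simp
    show "case_sum (\<lambda>a. a) (\<lambda>b. b) i \<in> E" if "i \<in> A <+> B" for i using that * by auto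
    show "f y + g y = (\<Sum>i\<in>A <+> B. case_sum c d i * ev (case_sum (\<lambda>a. a) (\<lambda>b. b) i) y)" if "y \<in> Y" for y
      using that * by (simp add: sum.Plus)
  qed
qed

lemma combination_mult:
  assumes mult: "\<And>a b. a \<in> E \<Longrightarrow> b \<in> E \<Longrightarrow> \<exists>c\<in>E. \<forall>y\<in>Y. ev c y = ev a y * ev b y"
    and "combination ev E Y f" "combination ev E Y g"
  shows "combination ev E Y (\<lambda>y. f y * g y)"
proof -
  obtain A c B d where *: "finite A" "A \<subseteq> E" "\<And>y. y \<in> Y \<Longrightarrow> f y = (\<Sum>a\<in>A. c a * ev a y)"
    "finite B" "B \<subseteq> E" "\<And>y. y \<in> Y \<Longrightarrow> g y = (\<Sum>b\<in>B. d b * ev b y)"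
    using assms unfolding combination_def by metis
  obtain p where p: "\<And>a b. a \<in> E \<Longrightarrow> b \<in> E \<Longrightarrow> p a b \<in> E"
    "\<And>a b y. a \<in> E \<Longrightarrow> b \<in> E \<Longrightarrow> y \<in> Y \<Longrightarrow> ev (p a b) y = ev a y * ev b y"
    using mult by metis
  show ?thesis
  proof (rule combination_indexed)
    show "finite (A \<times> B)" using * by simp
    show "(case i of (a, b) \<Rightarrow> p a b) \<in> E" if "i \<in> A \<times> B" for i
      using that * p(1) by (auto simp: subset_eq)
    show "f y * g y = (\<Sum>i\<in>A \<times> B. (case i of (a, b) \<Rightarrow> c a * d b) * ev (case i of (a, b) \<Rightarrow> p a b) y)"
      if "y \<in> Y" for y
    proof -
      have "f y * g y = (\<Sum>i\<in>A \<times> B. (case i of (a, b) \<Rightarrow> (c a * ev a y) * (d b * ev b y)))"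
        using that * by (simp add: sum_product sum.cartesian_product)
      also have "\<dots> = (\<Sum>i\<in>A \<times> B. (case i of (a, b) \<Rightarrow> c a * d b) * ev (case i of (a, b) \<Rightarrow> p a b) y)"
        using * p(2) that by (intro sum.cong refl) (auto simp: subset_eq algebra_simps)
      finally show ?thesis .
    qed
  qed
qed

text \<open>
  If the monomials are closed under products up to equality on \<open>Y\<close>, their span is an algebra of
  functions, so it contains every polynomial in functions that it contains.
\<close>

lemma combination_poly_function:
  assumes one: "\<exists>a\<in>E. \<forall>y\<in>Y. ev a y = 1"
    and mult: "\<And>a b. a \<in> E \<Longrightarrow> b \<in> E \<Longrightarrow> \<exists>c\<in>E. \<forall>y\<in>Y. ev c y = ev a y * ev b y"
    and coord: "\<And>i. i < n \<Longrightarrow> combination ev E Y (\<lambda>y. pt y ! i)"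
    and "P \<in> poly_functions n"
  shows "combination ev E Y (\<lambda>y. P (pt y))"
  using assms(4)
proof induction
  case (const c)
  obtain a where "a \<in> E" "\<forall>y\<in>Y. ev a y = 1" using one by blast
  then show ?case by (intro combination_indexed[of "{a}" "\<lambda>a. a" _ _ _ "\<lambda>_. c"]) auto
qed (auto intro: coord combination_add combination_mult[OF mult])

lemma separate_variables:
  assumes "P \<in> poly_functions (m + n)"
  shows "\<exists>A c. finite A \<and> A \<subseteq> poly_functions m \<times> poly_functions n \<and>
    (\<forall>y x. length y = m \<longrightarrow> P (y @ x) = (\<Sum>(p, q)\<in>A. c (p, q) * (p y * q x)))"
proof -
  let ?ev = "\<lambda>(p, q) (y, x). p y * q x"
  let ?E = "poly_functions m \<times> poly_functions n" and ?Y = "{y. length y = m} \<times> UNIV"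
  have "combination ?ev ?E ?Y (\<lambda>z. P (fst z @ snd z))"
  proof (rule combination_poly_function[OF _ _ _ assms])
    show "\<exists>a\<in>?E. \<forall>y\<in>?Y. ?ev a y = 1"
      by (intro bexI[of _ "(\<lambda>x. 1, \<lambda>x. 1)"]) (auto intro: poly_functions.const)
    show "\<exists>c\<in>?E. \<forall>y\<in>?Y. ?ev c y = ?ev a y * ?ev b y" if "a \<in> ?E" "b \<in> ?E" for a b
      using that by (intro bexI[of _ "(\<lambda>x. fst a x * fst b x, \<lambda>x. snd a x * snd b x)"])
        (auto intro: poly_functions.mult)
    show "combination ?ev ?E ?Y (\<lambda>z. (fst z @ snd z) ! i)" if "i < m + n" for i
    proof (cases "i < m")
      case True
      then show ?thesis
        by (intro combination_indexed[of "{()}" "\<lambda>_. (\<lambda>y. y ! i, \<lambda>x. 1)" _ _ _ "\<lambda>_. 1"])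
          (auto intro: poly_functions.intros simp: nth_append)
    next
      case False
      then show ?thesis using that
        by (intro combination_indexed[of "{()}" "\<lambda>_. (\<lambda>y. 1, \<lambda>x. x ! (i - m))" _ _ _ "\<lambda>_. 1"])
          (auto intro: poly_functions.intros simp: nth_append)
    qed
  qed
  then obtain A c where "finite A" "A \<subseteq> ?E"
    "\<forall>z\<in>?Y. P (fst z @ snd z) = (\<Sum>a\<in>A. c a * ?ev a z)"
    unfolding combination_def by blast
  then show ?thesis by (intro exI[of _ A] exI[of _ c]) (auto simp: case_prod_unfold)
qed

text \<open>
  Dedekind's argument: comparing a relation translated by \<open>s\<close> with its multiple by \<open>ev a0 s\<close> eliminates
  \<open>a0\<close> and keeps the coefficient of \<open>b\<close> up to the factor \<open>ev b s - ev a0 s\<close>, which is nonzero for a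
  suitable \<open>s\<close>.
\<close>

lemma characters_independent:
  fixes ev :: "'j \<Rightarrow> 'y \<Rightarrow> 'k::idom"
  assumes "finite A"
    and closed: "\<And>s t. s \<in> Y \<Longrightarrow> t \<in> Y \<Longrightarrow> mul s t \<in> Y"
    and unit: "e \<in> Y" "\<And>a. a \<in> A \<Longrightarrow> ev a e = 1"
    and mult: "\<And>a s t. a \<in> A \<Longrightarrow> s \<in> Y \<Longrightarrow> t \<in> Y \<Longrightarrow> ev a (mul s t) = ev a s * ev a t"
    and distinct: "\<And>a b. a \<in> A \<Longrightarrow> b \<in> A \<Longrightarrow> a \<noteq> b \<Longrightarrow> \<exists>s\<in>Y. ev a s \<noteq> ev b s"
    and "\<And>t. t \<in> Y \<Longrightarrow> (\<Sum>a\<in>A. c a * ev a t) = 0"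
    and "a \<in> A"
  shows "c a = 0"
  using assms(1,4-)
proof (induction A arbitrary: c a rule: finite_induct)
  case (insert a0 A)
  have zero: "c b = 0" if b: "b \<in> A" for b
  proof -
    obtain s where s: "s \<in> Y" "ev b s \<noteq> ev a0 s"
      using insert.prems(3)[of b a0] b insert.hyps(2) by blast
    have "(\<Sum>x\<in>A. c x * (ev x s - ev a0 s) * ev x t) = 0" if t: "t \<in> Y" for t
    proof -
      have "(\<Sum>x\<in>A. c x * (ev x s - ev a0 s) * ev x t)
          = (\<Sum>x\<in>insert a0 A. c x * (ev x s - ev a0 s) * ev x t)"
        using insert.hyps by simp
      also have "\<dots> = (\<Sum>x\<in>insert a0 A. c x * ev x (mul s t)) - ev a0 s * (\<Sum>x\<in>insert a0 A. c x * ev x t)"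
        unfolding sum_distrib_left sum_subtractf[symmetric]
        by (rule sum.cong) (auto simp: insert.prems(2) s t algebra_simps)
      also have "\<dots> = 0" using insert.prems(4) closed s t by simp
      finally show ?thesis .
    qed
    then have "c b * (ev b s - ev a0 s) = 0"
      using insert.IH[of "\<lambda>x. c x * (ev x s - ev a0 s)" b] insert.prems(1,2,3) b by simp
    then show ?thesis using s(2) by simp
  qed
  moreover have "c a0 = 0"
    using insert.prems(4)[OF unit(1)] insert.prems(1) insert.hyps zero by simp
  ultimately show ?case using insert.prems(5) by blast
qed simp

section \<open>Characters of the torus\<close>

text \<open>
  The lattice \<open>\<int>\<^sup>r\<close>; cutting off at \<open>r\<close> makes \<open>m \<mapsto> chi r m\<close> injective.
\<close>

definition exponents :: "nat \<Rightarrow> (nat \<Rightarrow> int) set" where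
  "exponents r = {m. \<forall>i\<ge>r. m i = 0}"

definition chi :: "nat \<Rightarrow> (nat \<Rightarrow> int) \<Rightarrow> 'k::field list \<Rightarrow> 'k" where
  "chi r m t = (\<Prod>i<r. t ! i powi m i)"

abbreviation torus_points :: "nat \<Rightarrow> 'k::field list set" where
  "torus_points r \<equiv> carrier (standard_torus r)"

lemma torus_points_iff:
  "t \<in> torus_points r \<longleftrightarrow> length t = 2 * r \<and> (\<forall>i<r. t ! i * t ! (r + i) = 1)"
  by (simp add: standard_torus_def)

lemma torus_mult: "s \<otimes>\<^bsub>standard_torus r\<^esub> t = map2 (*) s t"
  by (simp add: standard_torus_def)

lemma torus_closed: "s \<in> torus_points r \<Longrightarrow> t \<in> torus_points r \<Longrightarrow> map2 (*) s t \<in> torus_points r"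
  by (auto simp: torus_points_iff algebra_simps)

lemma torus_one_closed: "replicate (2 * r) 1 \<in> torus_points r"
  by (auto simp: torus_points_iff)

lemma torus_nonzero: "t \<in> torus_points r \<Longrightarrow> i < r \<Longrightarrow> t ! i \<noteq> 0"
  by (auto simp: torus_points_iff)

lemma exponents_add: "a \<in> exponents r \<Longrightarrow> b \<in> exponents r \<Longrightarrow> a + b \<in> exponents r"
  and exponents_diff: "a \<in> exponents r \<Longrightarrow> b \<in> exponents r \<Longrightarrow> a - b \<in> exponents r"
  and exponents_zero: "0 \<in> exponents r"
  by (auto simp: exponents_def)

lemma chi_zero: "chi r 0 t = 1"
  by (simp add: chi_def)

lemma chi_add: "t \<in> torus_points r \<Longrightarrow> chi r (a + b) t = chi r a t * chi r b t"
  unfolding chi_def prod.distrib[symmetric]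
  by (rule prod.cong) (auto simp: power_int_add torus_nonzero)

lemma chi_of_nat_mult: "t \<in> torus_points r \<Longrightarrow> chi r (of_nat k * a) t = chi r a t ^ k"
  by (induction k) (simp_all add: chi_zero chi_add distrib_right)

lemma chi_nonzero: "t \<in> torus_points r \<Longrightarrow> chi r a t \<noteq> 0"
  unfolding chi_def by (auto simp: torus_nonzero power_int_eq_0_iff)

lemma chi_mult:
  assumes "s \<in> torus_points r" "t \<in> torus_points r"
  shows "chi r a (map2 (*) s t) = chi r a s * chi r a t"
  unfolding chi_def prod.distrib[symmetric]
  by (rule prod.cong) (use assms in \<open>auto simp: torus_points_iff power_int_mult_distrib\<close>)

lemma chi_one: "chi r a (replicate (2 * r) 1) = 1"
  unfolding chi_def by simp

lemma chi_coordinate: "i < r \<Longrightarrow> t ! i = chi r (\<lambda>j. if j = i then 1 else 0) t"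
  unfolding chi_def by (simp add: if_distrib[of "\<lambda>k. _ powi k"] cong: if_cong)

lemma chi_inverse_coordinate:
  assumes "i < r" "t \<in> torus_points r"
  shows "t ! (r + i) = chi r (\<lambda>j. if j = i then - 1 else 0) t"
proof -
  have "chi r (\<lambda>j. if j = i then - 1 else 0) t = inverse (t ! i)"
    unfolding chi_def using assms(1)
    by (simp add: if_distrib[of "\<lambda>k. _ powi k"] power_int_minus cong: if_cong)
  moreover have "t ! i * t ! (r + i) = 1" using assms by (simp add: torus_points_iff)
  ultimately show ?thesis using inverse_unique[of "t ! i"] by simp
qed

lemma two_powi_inject:
  assumes "(2 :: 'k::field_char_0) powi a = 2 powi b"
  shows "a = b"
  using assms
proof (induction a b rule: linorder_wlog)
  case (le a b)
  then obtain k where k: "b = a + int k" using zle_iff_zadd by blast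
  have "(2 :: 'k) powi a * 2 ^ k = 2 powi a * 1" using le(2) unfolding k by (simp add: power_int_add)
  then have "(2 :: 'k) ^ k = 1" by simp
  then have "(of_nat (2 ^ k) :: 'k) = of_nat 1" by simp
  then have "k = 0" unfolding of_nat_eq_iff by (cases k) auto
  then show ?case using k by simp
qed auto

text \<open>
  A character is tested at the points that have one coordinate \<open>2\<close> and the others \<open>1\<close>; in characteristic
  zero, \<open>2\<close> has infinite order.
\<close>

lemma chi_injective:
  assumes "a \<in> exponents r" "b \<in> exponents r" "a \<noteq> b"
  shows "\<exists>s\<in>torus_points r. chi r a s \<noteq> (chi r b s :: 'k::field_char_0)"
proof -
  obtain i where i: "a i \<noteq> b i" using assms(3) by blast
  then have "i < r" using assms(1,2) unfolding exponents_def by (metis (mono_tags) mem_Collect_eq not_le)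
  define s :: "'k list" where
    "s = map (\<lambda>j. if j = i then 2 else if j = r + i then inverse 2 else 1) [0..<2 * r]"
  have "s \<in> torus_points r" using \<open>i < r\<close> by (auto simp: s_def torus_points_iff)
  moreover have "chi r m s = 2 powi m i" for m
  proof -
    have "chi r m s = (\<Prod>j<r. if j = i then 2 powi m i else 1)"
      unfolding chi_def by (rule prod.cong) (auto simp: s_def)
    then show ?thesis using \<open>i < r\<close> by simp
  qed
  moreover have "(2 :: 'k) powi a i \<noteq> 2 powi b i" using two_powi_inject i by blast
  ultimately show ?thesis by (intro bexI[of _ s]) simp_all
qed

lemma chi_independent:
  fixes c :: "(nat \<Rightarrow> int) \<Rightarrow> 'k::field_char_0"
  assumes "finite A" "A \<subseteq> exponents r" "\<And>t. t \<in> torus_points r \<Longrightarrow> (\<Sum>a\<in>A. c a * chi r a t) = 0" "a \<in> A"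
  shows "c a = 0"
  using assms(1) torus_closed torus_one_closed chi_one chi_mult
proof (rule characters_independent)
  show "\<exists>s\<in>torus_points r. chi r a s \<noteq> (chi r b s :: 'k)" if "a \<in> A" "b \<in> A" "a \<noteq> b" for a b
    using chi_injective that assms(2) by blast
qed (use assms in auto)

lemma chi_combination_unique:
  fixes c d :: "(nat \<Rightarrow> int) \<Rightarrow> 'k::field_char_0"
  assumes "finite A" "finite B" "A \<subseteq> exponents r" "B \<subseteq> exponents r"
    and "\<And>t. t \<in> torus_points r \<Longrightarrow> (\<Sum>a\<in>A. c a * chi r a t) = (\<Sum>b\<in>B. d b * chi r b t)"
    and "a \<in> A" "c a \<noteq> 0"
  shows "a \<in> B"
proof (rule ccontr)
  assume "a \<notin> B"
  define e where "e x = (if x \<in> A then c x else 0) - (if x \<in> B then d x else 0)" for x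
  have "(\<Sum>x\<in>A \<union> B. e x * chi r x t) = 0" if "t \<in> torus_points r" for t
  proof -
    have "(\<Sum>x\<in>A \<union> B. e x * chi r x t) = (\<Sum>x\<in>A \<union> B. (if x \<in> A then c x * chi r x t else 0))
        - (\<Sum>x\<in>A \<union> B. (if x \<in> B then d x * chi r x t else 0))"
      unfolding sum_subtractf[symmetric] by (rule sum.cong) (auto simp: e_def algebra_simps)
    also have "\<dots> = (\<Sum>a\<in>A. c a * chi r a t) - (\<Sum>b\<in>B. d b * chi r b t)"
      using assms(1,2) by (simp add: sum.If_cases Int_absorb1)
    finally show ?thesis using assms(5)[OF that] by simp
  qed
  then have "e a = 0" using assms by (intro chi_independent[of "A \<union> B" r e]) auto
  then show False using \<open>a \<notin> B\<close> assms(6,7) by (simp add: e_def)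
qed

text \<open>
  Both \<open>t\<^sub>i\<close> and its inverse, which is the coordinate \<open>r + i\<close>, are characters, so a polynomial in the coordinates
  of \<open>t\<close> and \<open>x\<close> becomes a Laurent polynomial in \<open>t\<close> with coefficients that are polynomial in \<open>x\<close>.
\<close>

lemma torus_separate_variables:
  fixes P :: "'k::field list \<Rightarrow> 'k"
  assumes "P \<in> poly_functions (2 * r + n)"
  shows "\<exists>A c. finite A \<and> A \<subseteq> exponents r \<and> (\<forall>a\<in>A. c a \<in> poly_functions n) \<and>
    (\<forall>t\<in>torus_points r. \<forall>x. P (t @ x) = (\<Sum>a\<in>A. chi r a t * c a x))"
proof -
  let ?ev = "\<lambda>(a, q) (t, x). chi r a t * q x"
  let ?E = "exponents r \<times> (poly_functions n :: ('k list \<Rightarrow> 'k) set)" and ?Y = "torus_points r \<times> UNIV"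
  have "combination ?ev ?E ?Y (\<lambda>z. P (fst z @ snd z))"
  proof (rule combination_poly_function[OF _ _ _ assms])
    show "\<exists>a\<in>?E. \<forall>y\<in>?Y. ?ev a y = 1"
      by (intro bexI[of _ "(0, \<lambda>x. 1)"]) (auto intro: poly_functions.const simp: chi_zero exponents_zero)
    show "\<exists>c\<in>?E. \<forall>y\<in>?Y. ?ev c y = ?ev a y * ?ev b y" if "a \<in> ?E" "b \<in> ?E" for a b
      using that by (intro bexI[of _ "(fst a + fst b, \<lambda>x. snd a x * snd b x)"])
        (auto intro: poly_functions.mult exponents_add simp: chi_add)
    show "combination ?ev ?E ?Y (\<lambda>z. (fst z @ snd z) ! i)" if i: "i < 2 * r + n" for i
    proof -
      consider "i < r" | "r \<le> i" "i < 2 * r" | "2 * r \<le> i" by linarith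
      then show ?thesis
      proof cases
        case 1
        then show ?thesis
          by (intro combination_indexed[of "{()}" "\<lambda>_. (\<lambda>j. if j = i then 1 else 0, \<lambda>x. 1)" _ _ _ "\<lambda>_. 1"])
            (auto intro: poly_functions.intros simp: nth_append torus_points_iff exponents_def chi_coordinate[of i r])
      next
        case 2
        then have "t ! i = chi r (\<lambda>j. if j = i - r then - 1 else 0) t"
          if "t \<in> torus_points r" for t :: "'k list"
          using chi_inverse_coordinate[of "i - r" r t] that by simp
        with 2 show ?thesis
          by (intro combination_indexed[of "{()}" "\<lambda>_. (\<lambda>j. if j = i - r then - 1 else 0, \<lambda>x. 1)" _ _ _ "\<lambda>_. 1"])
            (auto intro: poly_functions.intros simp: nth_append torus_points_iff exponents_def)
      next
        case 3
        then show ?thesis using i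
          by (intro combination_indexed[of "{()}" "\<lambda>_. (0, \<lambda>x. x ! (i - 2 * r))" _ _ _ "\<lambda>_. 1"])
            (auto intro: poly_functions.intros simp: nth_append torus_points_iff chi_zero exponents_zero)
      qed
    qed
  qed
  then obtain B d where B: "finite B" "B \<subseteq> ?E"
    "\<forall>z\<in>?Y. P (fst z @ snd z) = (\<Sum>b\<in>B. d b * ?ev b z)"
    unfolding combination_def by blast
  define c where "c a x = (\<Sum>b\<in>{b \<in> B. fst b = a}. d b * snd b x)" for a x
  have "P (t @ x) = (\<Sum>a\<in>fst ` B. chi r a t * c a x)" if "t \<in> torus_points r" for t x
  proof -
    have "P (t @ x) = (\<Sum>b\<in>B. d b * ?ev b (t, x))" using B(3) that by force
    also have "\<dots> = (\<Sum>a\<in>fst ` B. \<Sum>b\<in>{b \<in> B. fst b = a}. d b * ?ev b (t, x))"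
      by (rule sum.image_gen[OF B(1)])
    also have "\<dots> = (\<Sum>a\<in>fst ` B. chi r a t * c a x)"
      unfolding c_def sum_distrib_left by (intro sum.cong refl) (auto simp: algebra_simps)
    finally show ?thesis .
  qed
  moreover have "c a \<in> poly_functions n" for a
    unfolding c_def using B(2) by (intro poly_functions_sum poly_functions_scale) auto
  ultimately show ?thesis using B(1,2) by (intro exI[of _ "fst ` B"] exI[of _ c]) auto
qed

section \<open>Affine varieties with an open torus orbit\<close>

lemma zariski_closed_subset: "zariski_closed n X \<Longrightarrow> X \<subseteq> affine_space n"
  unfolding zariski_closed_def by auto

lemma zariski_closed_zeros:
  assumes "zariski_closed n X" "p \<in> poly_functions n"
  shows "zariski_closed n {x \<in> X. p x = 0}"
proof -
  obtain S where "S \<subseteq> poly_functions n" "X = {x \<in> affine_space n. \<forall>p\<in>S. p x = 0}"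
    using assms(1) unfolding zariski_closed_def by blast
  then show ?thesis
    using assms(2) unfolding zariski_closed_def by (intro exI[of _ "insert p S"]) auto
qed

lemma zariski_closed_separate:
  assumes "zariski_closed n X" "x \<in> affine_space n" "x \<notin> X"
  obtains p where "p \<in> poly_functions n" "p x \<noteq> 0" "\<And>y. y \<in> X \<Longrightarrow> p y = 0"
  using assms unfolding zariski_closed_def by blast

lemma coord_ring_carrier_iff:
  "f \<in> carrier (coord_ring n X) \<longleftrightarrow> (\<exists>p\<in>poly_functions n. f = restrict p X)"
  by (auto simp: coord_ring_def)

text \<open>
  The torus of an affine toric variety is only isomorphic to a standard one. Here the isomorphism has
  been absorbed into the action.
\<close>

locale torus_embedding =
  fixes n :: nat and X :: "'k::field_char_0 list set" and r :: nat
    and act :: "'k list \<Rightarrow> 'k list \<Rightarrow> 'k list" and x0 :: "'k list"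
  assumes irreducible: "irreducible_variety n X"
    and normal: "normal_variety n X"
    and units: "Units (coord_ring n X) = {\<lambda>x\<in>X. c | c. c \<noteq> 0}"
    and act_closed: "t \<in> torus_points r \<Longrightarrow> x \<in> X \<Longrightarrow> act t x \<in> X"
    and act_one: "x \<in> X \<Longrightarrow> act (replicate (2 * r) 1) x = x"
    and act_mult: "s \<in> torus_points r \<Longrightarrow> t \<in> torus_points r \<Longrightarrow> x \<in> X \<Longrightarrow>
      act (map2 (*) s t) x = act s (act t x)"
    and act_regular: "i < n \<Longrightarrow> \<exists>P\<in>poly_functions (2 * r + n).
      \<forall>t\<in>torus_points r. \<forall>x\<in>X. act t x ! i = P (t @ x)"
    and base_point: "x0 \<in> X"
    and open_orbit: "zariski_closed n (X - (\<lambda>t. act t x0) ` torus_points r)"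
begin

abbreviation orb :: "'k list \<Rightarrow> 'k list" where
  "orb t \<equiv> act t x0"

lemma closed: "zariski_closed n X"
  using irreducible unfolding irreducible_variety_def by blast

lemma length_X: "x \<in> X \<Longrightarrow> length x = n"
  using zariski_closed_subset[OF closed] by (auto simp: affine_space_def)

lemma orb_closed: "t \<in> torus_points r \<Longrightarrow> orb t \<in> X"
  by (rule act_closed[OF _ base_point])

lemma orb_one: "orb (replicate (2 * r) 1) = x0"
  by (rule act_one[OF base_point])

text \<open>
  The closed sets \<open>X - T x0\<close> and \<open>{p = 0}\<close> cover the irreducible \<open>X\<close>, and the first one misses \<open>x0\<close>.
\<close>

lemma orbit_dense:
  assumes "p \<in> poly_functions n" "\<And>t. t \<in> torus_points r \<Longrightarrow> p (orb t) = 0" "x \<in> X"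
  shows "p x = 0"
proof -
  define Y where "Y = X - orb ` torus_points r"
  define Z where "Z = {x \<in> X. p x = 0}"
  have "X = Y \<union> Z" using assms(2) orb_closed unfolding Y_def Z_def by auto
  moreover have "zariski_closed n Y" "zariski_closed n Z"
    using open_orbit zariski_closed_zeros[OF closed assms(1)] unfolding Y_def Z_def by auto
  moreover have "X \<noteq> Y" using orb_closed[OF torus_one_closed] torus_one_closed unfolding Y_def by blast
  ultimately have "X = Z" using irreducible unfolding irreducible_variety_def by blast
  then show ?thesis using assms(3) unfolding Z_def by blast
qed

lemma orbit_dense_eq:
  assumes "p \<in> poly_functions n" "q \<in> poly_functions n"
    "\<And>t. t \<in> torus_points r \<Longrightarrow> p (orb t) = q (orb t)" "x \<in> X"
  shows "p x = q x"
  using orbit_dense[OF poly_functions_diff[OF assms(1,2)] _ assms(4)] assms(3) by simp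

definition weights :: "(nat \<Rightarrow> int) set" where
  "weights = {m \<in> exponents r. \<exists>h\<in>poly_functions n. \<forall>t\<in>torus_points r. h (orb t) = chi r m t}"

text \<open>
  The regular function on \<open>X\<close> whose pullback to the torus is \<open>\<chi>\<^sup>m\<close>. Only its values on \<open>X\<close> matter, and
  there it is unique by density of the orbit.
\<close>

definition weight_fun :: "(nat \<Rightarrow> int) \<Rightarrow> 'k list \<Rightarrow> 'k" where
  "weight_fun m = (SOME h. h \<in> poly_functions n \<and> (\<forall>t\<in>torus_points r. h (orb t) = chi r m t))"

lemma weights_exponents: "weights \<subseteq> exponents r"
  unfolding weights_def by blast

lemma weight_fun:
  assumes "m \<in> weights"
  shows "weight_fun m \<in> poly_functions n" "\<And>t. t \<in> torus_points r \<Longrightarrow> weight_fun m (orb t) = chi r m t"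
proof -
  have "\<exists>h. h \<in> poly_functions n \<and> (\<forall>t\<in>torus_points r. h (orb t) = chi r m t)"
    using assms unfolding weights_def by blast
  from someI_ex[OF this] show "weight_fun m \<in> poly_functions n"
    "\<And>t. t \<in> torus_points r \<Longrightarrow> weight_fun m (orb t) = chi r m t"
    unfolding weight_fun_def by blast+
qed

lemma weightsI:
  "m \<in> exponents r \<Longrightarrow> h \<in> poly_functions n \<Longrightarrow> (\<And>t. t \<in> torus_points r \<Longrightarrow> h (orb t) = chi r m t)
    \<Longrightarrow> m \<in> weights"
  unfolding weights_def by blast

lemma weights_zero: "0 \<in> weights"
  by (rule weightsI[of _ "\<lambda>x. 1"]) (auto simp: exponents_zero chi_zero intro: poly_functions.const)

lemma weights_add: "a \<in> weights \<Longrightarrow> b \<in> weights \<Longrightarrow> a + b \<in> weights"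
  using weights_exponents
  by (intro weightsI[of _ "\<lambda>x. weight_fun a x * weight_fun b x"])
    (auto intro: exponents_add poly_functions.mult weight_fun(1) simp: weight_fun(2) chi_add)

lemma weights_mult: "a \<in> weights \<Longrightarrow> of_nat k * a \<in> weights"
  by (rule submonoid_mult) (auto intro: weights_zero weights_add)

text \<open>
  Expand \<open>P (t x)\<close> as a Laurent polynomial in \<open>t\<close> with coefficients \<open>c a\<close>. Comparing \<open>P (t (s x0))\<close> with
  \<open>P ((t s) x0)\<close>, linear independence of characters gives \<open>c a (s x0) = \<chi>\<^sup>a(s) c a (x0)\<close>. Hence
  whenever \<open>c a\<close> does not vanish at \<open>x0\<close>, a multiple of it witnesses that \<open>a\<close> is a weight.
\<close>

lemma combination_orbit:
  assumes P: "P \<in> poly_functions n"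
  shows "combination (chi r) weights (torus_points r) (\<lambda>t. P (orb t))"
proof -
  obtain R where R: "\<And>i. i < n \<Longrightarrow> R i \<in> poly_functions (2 * r + n)"
    "\<And>i t x. i < n \<Longrightarrow> t \<in> torus_points r \<Longrightarrow> x \<in> X \<Longrightarrow> act t x ! i = R i (t @ x)"
    using act_regular by metis
  define Q where "Q z = P (map (\<lambda>i. R i z) [0..<n])" for z
  have "Q \<in> poly_functions (2 * r + n)"
    unfolding Q_def by (rule poly_functions_compose[OF P R(1)])
  then obtain A c where A: "finite A" "A \<subseteq> exponents r" "\<And>a. a \<in> A \<Longrightarrow> c a \<in> poly_functions n"
    "\<And>t x. t \<in> torus_points r \<Longrightarrow> Q (t @ x) = (\<Sum>a\<in>A. chi r a t * c a x)"
    using torus_separate_variables[of Q r n] by metis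
  have act: "P (act t x) = (\<Sum>a\<in>A. chi r a t * c a x)" if "t \<in> torus_points r" "x \<in> X" for t x
  proof -
    have "act t x = map (\<lambda>i. R i (t @ x)) [0..<n]"
      using R(2) that length_X[OF act_closed] by (intro nth_equalityI) auto
    then show ?thesis using A(4)[OF that(1), of x] unfolding Q_def by simp
  qed
  have eigen: "c a (orb s) = chi r a s * c a x0" if s: "s \<in> torus_points r" and "a \<in> A" for a s
  proof -
    have "(\<Sum>a\<in>A. (c a (orb s) - chi r a s * c a x0) * chi r a t) = 0" if t: "t \<in> torus_points r" for t :: "'k list"
    proof -
      have "(\<Sum>a\<in>A. chi r a t * c a (orb s)) = P (act t (orb s))"
        using act[OF t orb_closed[OF s]] ..
      also have "\<dots> = P (act (map2 (*) t s) x0)" using act_mult[OF t s base_point] by simp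
      also have "\<dots> = (\<Sum>a\<in>A. chi r a (map2 (*) t s) * c a x0)"
        by (rule act[OF torus_closed[OF t s] base_point])
      also have "\<dots> = (\<Sum>a\<in>A. chi r a t * (chi r a s * c a x0))"
        by (simp only: chi_mult[OF t s] mult.assoc)
      finally show ?thesis by (simp add: algebra_simps sum_subtractf)
    qed
    then have "c a (orb s) - chi r a s * c a x0 = 0"
      using chi_independent[OF A(1,2), of "\<lambda>a. c a (orb s) - chi r a s * c a x0" a] \<open>a \<in> A\<close> by blast
    then show ?thesis by simp
  qed
  define A' where "A' = {a \<in> A. c a x0 \<noteq> 0}"
  show ?thesis
    unfolding combination_def
  proof (intro exI conjI ballI)
    show "finite A'" using A(1) unfolding A'_def by simp
    show "A' \<subseteq> weights"
    proof
      fix a assume "a \<in> A'"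
      then have a: "a \<in> A" "c a x0 \<noteq> 0" unfolding A'_def by auto
      then show "a \<in> weights"
        using A(2) by (intro weightsI[of _ "\<lambda>x. inverse (c a x0) * c a x"])
          (auto intro!: poly_functions_scale A(3) simp: eigen)
    qed
    fix t :: "'k list" assume t: "t \<in> torus_points r"
    have "P (orb t) = (\<Sum>a\<in>A. c a x0 * chi r a t)"
      using act[OF t base_point] by (simp add: mult.commute)
    also have "\<dots> = (\<Sum>a\<in>A'. c a x0 * chi r a t)"
      using A(1) unfolding A'_def by (intro sum.mono_neutral_right) auto
    finally show "P (orb t) = (\<Sum>a\<in>A'. c a x0 * chi r a t)" .
  qed
qed

lemma weight_fun_combination_poly:
  "A \<subseteq> weights \<Longrightarrow> (\<lambda>x. \<Sum>a\<in>A. c a * weight_fun a x) \<in> poly_functions n"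
  by (intro poly_functions_sum poly_functions_scale weight_fun(1)) blast

lemma combination_weight_fun:
  assumes P: "P \<in> poly_functions n"
  shows "combination weight_fun weights X P"
proof -
  obtain A c where A: "finite A" "A \<subseteq> weights"
    "\<And>t. t \<in> torus_points r \<Longrightarrow> P (orb t) = (\<Sum>a\<in>A. c a * chi r a t)"
    using combination_orbit[OF P] unfolding combination_def by blast
  have "(\<Sum>a\<in>A. c a * weight_fun a (orb t)) = (\<Sum>a\<in>A. c a * chi r a t)" if "t \<in> torus_points r" for t :: "'k list"
    using A(2) weight_fun(2)[OF _ that] by (intro sum.cong) auto
  then have "P x = (\<Sum>a\<in>A. c a * weight_fun a x)" if "x \<in> X" for x
    using A(3) by (intro orbit_dense_eq[OF P weight_fun_combination_poly[OF A(2)] _ that]) simp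
  then show ?thesis unfolding combination_def using A(1,2) by blast
qed

definition coord_support :: "nat \<Rightarrow> (nat \<Rightarrow> int) set" where
  "coord_support i = (SOME A. finite A \<and> A \<subseteq> weights \<and>
    (\<exists>c. \<forall>x\<in>X. x ! i = (\<Sum>a\<in>A. c a * weight_fun a x)))"

definition coord_coeff :: "nat \<Rightarrow> (nat \<Rightarrow> int) \<Rightarrow> 'k" where
  "coord_coeff i = (SOME c. \<forall>x\<in>X. x ! i = (\<Sum>a\<in>coord_support i. c a * weight_fun a x))"

lemma coord_support:
  assumes "i < n"
  shows "finite (coord_support i)" "coord_support i \<subseteq> weights"
    "\<And>x. x \<in> X \<Longrightarrow> x ! i = (\<Sum>a\<in>coord_support i. coord_coeff i a * weight_fun a x)"
proof -
  have "\<exists>A. finite A \<and> A \<subseteq> weights \<and> (\<exists>c. \<forall>x\<in>X. x ! i = (\<Sum>a\<in>A. c a * weight_fun a x))"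
    using combination_weight_fun[OF poly_functions.coordinate[OF assms]] unfolding combination_def by simp
  note A = someI_ex[OF this, folded coord_support_def]
  then show "finite (coord_support i)" "coord_support i \<subseteq> weights" by simp_all
  have "\<exists>c. \<forall>x\<in>X. x ! i = (\<Sum>a\<in>coord_support i. c a * weight_fun a x)" using A by simp
  from someI_ex[OF this, folded coord_coeff_def]
  show "\<And>x. x \<in> X \<Longrightarrow> x ! i = (\<Sum>a\<in>coord_support i. coord_coeff i a * weight_fun a x)" by simp
qed

text \<open>
  Only finitely many characters occur in the coordinates of a point of \<open>X\<close>. A character that is a
  polynomial in the coordinates is a combination of products of these, hence equal to one of them by
  linear independence.
\<close>

lemma weights_finitely_generated:
  "\<exists>A. finite A \<and> A \<subseteq> weights \<and> (\<forall>m\<in>weights. \<exists>c. m = (\<Sum>a\<in>A. of_nat (c a) * a))"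
proof -
  define A where "A = (\<Union>i<n. coord_support i)"
  define E where "E = range (\<lambda>c. \<Sum>a\<in>A. of_nat (c a) * a)"
  have EI: "(\<Sum>a\<in>A. of_nat (c a) * a) \<in> E" for c unfolding E_def by (rule rangeI)
  have A: "finite A" "A \<subseteq> weights" using coord_support(1,2) unfolding A_def by auto
  have E_weights: "E \<subseteq> weights"
    unfolding E_def using A(2)
    by (auto intro!: submonoid_sum[of weights] weights_zero weights_add weights_mult)
  have A_E: "a \<in> E" if "a \<in> A" for a
  proof -
    have "a = (\<Sum>x\<in>A. if x = a then a else 0)" using A(1) that by simp
    also have "\<dots> = (\<Sum>x\<in>A. of_nat (if x = a then 1 else 0) * x)" by (rule sum.cong) auto
    also have "\<dots> \<in> E" by (rule EI)
    finally show ?thesis .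
  qed
  have "\<exists>c. m = (\<Sum>a\<in>A. of_nat (c a) * a)" if m: "m \<in> weights" for m
  proof -
    have "combination (chi r) E (torus_points r) (\<lambda>t. weight_fun m (orb t))"
    proof (rule combination_poly_function[OF _ _ _ weight_fun(1)[OF m]])
      have "0 \<in> E" using EI[of "\<lambda>_. 0"] by simp
      then show "\<exists>a\<in>E. \<forall>t\<in>torus_points r. chi r a t = 1" using chi_zero by blast
      show "\<exists>c\<in>E. \<forall>y\<in>torus_points r. chi r c y = chi r a y * chi r b y" if "a \<in> E" "b \<in> E" for a b
      proof -
        obtain f g where fg: "a = (\<Sum>a\<in>A. of_nat (f a) * a)" "b = (\<Sum>a\<in>A. of_nat (g a) * a)"
          using \<open>a \<in> E\<close> \<open>b \<in> E\<close> unfolding E_def by blast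
        have "a + b = (\<Sum>a\<in>A. of_nat (f a + g a) * a)"
          unfolding fg by (simp add: sum.distrib distrib_right)
        then have "a + b \<in> E" by (simp only: EI)
        then show ?thesis using chi_add by blast
      qed
      show "combination (chi r) E (torus_points r) (\<lambda>t. orb t ! i)" if i: "i < n" for i
        unfolding combination_def
      proof (intro exI[of _ "coord_support i"] exI[of _ "coord_coeff i"] conjI ballI)
        show "coord_support i \<subseteq> E" using A_E i unfolding A_def by blast
        show "orb t ! i = (\<Sum>a\<in>coord_support i. coord_coeff i a * chi r a t)"
          if t: "t \<in> torus_points r" for t :: "'k list"
          unfolding coord_support(3)[OF i orb_closed[OF t]]
          using coord_support(2)[OF i] weight_fun(2)[OF _ t] by (intro sum.cong) auto
      qed (rule coord_support(1)[OF i])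
    qed
    then obtain C c where C: "finite C" "C \<subseteq> E"
      "\<forall>t\<in>torus_points r. weight_fun m (orb t) = (\<Sum>a\<in>C. c a * chi r a t)"
      unfolding combination_def by blast
    then have "chi r m t = (\<Sum>a\<in>C. c a * chi r a t)" if "t \<in> torus_points r" for t :: "'k list"
      using weight_fun(2)[OF m that] that by simp
    moreover have "C \<subseteq> exponents r" "m \<in> exponents r"
      using C(2) E_weights weights_exponents m by blast+
    ultimately have "m \<in> C"
      using chi_combination_unique[of "{m}" C r "\<lambda>_. 1" c m] C(1) by simp
    then show ?thesis using C(2) unfolding E_def by blast
  qed
  then show ?thesis using A by blast
qed

text \<open>
  The quotient of the functions with exponents \<open>a\<close> and \<open>b\<close> is a root of the monic equation
  \<open>z\<^sup>k - \<chi>\<^bsup>k(a-b)\<^esup> = 0\<close>, so it is regular because \<open>X\<close> is normal.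
\<close>

lemma weights_saturated:
  assumes a: "a \<in> weights" and b: "b \<in> weights" and k: "k > 0" and kab: "of_nat k * (a - b) \<in> weights"
  shows "a - b \<in> weights"
proof -
  let ?a = "restrict (weight_fun a) X" and ?b = "restrict (weight_fun b) X"
  have chi_ab: "chi r a t = chi r (a - b) t * chi r b t" if "t \<in> torus_points r" for t :: "'k list"
    using chi_add[OF that, of "a - b" b] by simp
  have power: "weight_fun a x ^ k = weight_fun (of_nat k * (a - b)) x * weight_fun b x ^ k" if "x \<in> X" for x
  proof (rule orbit_dense_eq[OF _ _ _ that])
    show "(\<lambda>x. weight_fun a x ^ k) \<in> poly_functions n"
      "(\<lambda>x. weight_fun (of_nat k * (a - b)) x * weight_fun b x ^ k) \<in> poly_functions n"
      by (intro poly_functions.mult poly_functions_power weight_fun(1) a b kab)+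
    show "weight_fun a (orb t) ^ k = weight_fun (of_nat k * (a - b)) (orb t) * weight_fun b (orb t) ^ k"
      if t: "t \<in> torus_points r" for t :: "'k list"
      unfolding weight_fun(2)[OF a t] weight_fun(2)[OF b t] weight_fun(2)[OF kab t] chi_of_nat_mult[OF t]
        chi_ab[OF t] power_mult_distrib ..
  qed
  define c where "c i = (if i = 0 then restrict (\<lambda>x. - 1 * weight_fun (of_nat k * (a - b)) x) X
      else restrict (\<lambda>x. 0) X)" for i :: nat
  have "integral_quotient n X ?a ?b"
    unfolding integral_quotient_def
  proof (intro exI[of _ k] exI[of _ c] conjI allI impI ballI)
    show "k \<ge> 1" using k by simp
    show "c i \<in> carrier (coord_ring n X)" for i
      unfolding c_def coord_ring_carrier_iff
      using poly_functions_scale[OF weight_fun(1)[OF kab], of "- 1"] poly_functions.const[of 0 n] by auto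
    fix x assume x: "x \<in> X" "?b x \<noteq> 0"
    have "(\<Sum>i<k. c i x * (?a x / ?b x) ^ i) = (\<Sum>i<k. if i = 0 then c 0 x else 0)"
      using x by (intro sum.cong) (auto simp: c_def)
    also have "\<dots> = - weight_fun (of_nat k * (a - b)) x" using k x by (simp add: c_def)
    finally show "(?a x / ?b x) ^ k + (\<Sum>i<k. c i x * (?a x / ?b x) ^ i) = 0"
      using x power[OF x(1)] by (simp add: power_divide)
  qed
  moreover have "?b \<noteq> \<zero>\<^bsub>coord_ring n X\<^esub>"
  proof
    assume "?b = \<zero>\<^bsub>coord_ring n X\<^esub>"
    then have "?b = (\<lambda>x\<in>X. 0)" by (simp add: coord_ring_def)
    from fun_cong[OF this, of x0] have "weight_fun b x0 = 0" using base_point by simp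
    then show False using weight_fun(2)[OF b torus_one_closed] by (simp add: orb_one chi_one)
  qed
  moreover have "?a \<in> carrier (coord_ring n X)" "?b \<in> carrier (coord_ring n X)"
    unfolding coord_ring_carrier_iff using weight_fun(1) a b by blast+
  ultimately obtain h where h: "h \<in> carrier (coord_ring n X)" "\<And>x. x \<in> X \<Longrightarrow> ?b x \<noteq> 0 \<Longrightarrow> ?a x / ?b x = h x"
    using normal unfolding normal_variety_def by blast
  obtain p where p: "p \<in> poly_functions n" "h = restrict p X"
    using h(1) unfolding coord_ring_carrier_iff by blast
  show ?thesis
  proof (rule weightsI[OF _ p(1)])
    show "a - b \<in> exponents r" using a b weights_exponents exponents_diff by blast
    fix t :: "'k list" assume t: "t \<in> torus_points r"
    have "chi r a t / chi r b t = p (orb t)"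
      using h(2)[OF orb_closed[OF t]] orb_closed[OF t] weight_fun(2)[OF a t] weight_fun(2)[OF b t]
        chi_nonzero[OF t] p(2) by simp
    then show "p (orb t) = chi r (a - b) t" using chi_ab[OF t] chi_nonzero[OF t, of b] by simp
  qed
qed

lemma weights_pointed:
  assumes a: "a \<in> weights" and a': "- a \<in> weights"
  shows "a = 0"
proof (rule ccontr)
  assume "a \<noteq> 0"
  let ?u = "restrict (weight_fun a) X" and ?v = "restrict (weight_fun (- a)) X"
  have inv: "weight_fun a x * weight_fun (- a) x = 1" if "x \<in> X" for x
  proof (rule orbit_dense_eq[OF _ _ _ that])
    show "(\<lambda>x. weight_fun a x * weight_fun (- a) x) \<in> poly_functions n" "(\<lambda>x. 1) \<in> poly_functions n"
      by (intro poly_functions.mult poly_functions.const weight_fun(1) a a')+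
    show "weight_fun a (orb t) * weight_fun (- a) (orb t) = 1" if t: "t \<in> torus_points r" for t :: "'k list"
      using chi_add[OF t, of a "- a"] by (simp add: weight_fun(2)[OF _ t] a a' chi_zero)
  qed
  have "?u \<in> Units (coord_ring n X)"
    unfolding Units_def
  proof (intro CollectI conjI bexI[of _ ?v])
    show "?u \<in> carrier (coord_ring n X)" "?v \<in> carrier (coord_ring n X)"
      unfolding coord_ring_carrier_iff using weight_fun(1) a a' by blast+
    show "?v \<otimes>\<^bsub>coord_ring n X\<^esub> ?u = \<one>\<^bsub>coord_ring n X\<^esub>" "?u \<otimes>\<^bsub>coord_ring n X\<^esub> ?v = \<one>\<^bsub>coord_ring n X\<^esub>"
      using inv by (auto simp: coord_ring_def fun_eq_iff mult.commute)
  qed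
  then obtain c where c: "?u = (\<lambda>x\<in>X. c)" unfolding units by blast
  have chi: "chi r a t = c" if "t \<in> torus_points r" for t :: "'k list"
    using fun_cong[OF c, of "orb t"] orb_closed[OF that] weight_fun(2)[OF a that] by simp
  obtain s where "s \<in> torus_points r" "chi r a s \<noteq> (chi r 0 s :: 'k)"
    using chi_injective[of a r 0] a weights_exponents exponents_zero \<open>a \<noteq> 0\<close> by blast
  then show False using chi chi[OF torus_one_closed] by (simp add: chi_zero chi_one)
qed

lemma fg_monoid_weights: "\<exists>A. fg_monoid weights A"
proof -
  obtain A where "finite A" "A \<subseteq> weights" "\<forall>m\<in>weights. \<exists>c. m = (\<Sum>a\<in>A. of_nat (c a) * a)"
    using weights_finitely_generated by blast
  then have "fg_monoid weights A"
    by unfold_locales (auto intro: weights_zero weights_add weights_saturated weights_pointed)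
  then show ?thesis ..
qed

lemma poly_in_one_weight:
  assumes u: "u \<in> weights" and "\<And>m. m \<in> weights \<Longrightarrow> \<exists>k. m = of_nat k * u"
    and P: "P \<in> poly_functions n"
  shows "\<exists>Q. \<forall>x\<in>X. P x = poly Q (weight_fun u x)"
proof -
  obtain \<kappa> where \<kappa>: "\<And>m. m \<in> weights \<Longrightarrow> m = of_nat (\<kappa> m) * u" using assms(2) by metis
  have pow: "weight_fun m x = weight_fun u x ^ \<kappa> m" if m: "m \<in> weights" and "x \<in> X" for m x
  proof (rule orbit_dense_eq[OF weight_fun(1)[OF m] poly_functions_power[OF weight_fun(1)[OF u]] _ \<open>x \<in> X\<close>])
    show "weight_fun m (orb t) = weight_fun u (orb t) ^ \<kappa> m" if t: "t \<in> torus_points r" for t :: "'k list"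
      using chi_of_nat_mult[OF t, of "\<kappa> m" u] \<kappa>[OF m] by (simp add: weight_fun(2)[OF _ t] m u)
  qed
  obtain A c where A: "finite A" "A \<subseteq> weights" "\<And>x. x \<in> X \<Longrightarrow> P x = (\<Sum>a\<in>A. c a * weight_fun a x)"
    using combination_weight_fun[OF P] unfolding combination_def by blast
  have "P x = poly (\<Sum>a\<in>A. monom (c a) (\<kappa> a)) (weight_fun u x)" if "x \<in> X" for x
    using A that pow by (auto simp: poly_sum poly_monom intro!: sum.cong)
  then show ?thesis by blast
qed

text \<open>
  The function \<open>y\<close> with exponent \<open>u\<close> is injective on \<open>X\<close>, because all coordinates are polynomials in it. A
  proper closed subset lies in the zero set of a nonzero polynomial in \<open>y\<close>, so it is finite, and it is
  a single point if it is irreducible.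
\<close>

lemma dim_one_weight:
  assumes u: "u \<in> weights" and gen: "\<And>m. m \<in> weights \<Longrightarrow> \<exists>k. m = of_nat k * u"
  shows "variety_dim n X \<le> 1"
  unfolding variety_dim_def
proof (rule Sup_least, clarify)
  let ?y = "weight_fun u"
  fix d and Z :: "nat \<Rightarrow> 'k list set"
  assume Z: "\<forall>i\<le>d. irreducible_variety n (Z i) \<and> Z i \<subseteq> X" "\<forall>i<d. Z i \<subset> Z (Suc i)"
  show "enat d \<le> 1"
  proof (rule ccontr)
    assume "\<not> enat d \<le> 1"
    then have d: "d \<ge> 2" by (simp add: one_enat_def)
    have inj: "inj_on ?y X"
    proof (rule inj_onI)
      fix x x' assume x: "x \<in> X" "x' \<in> X" "?y x = ?y x'"
      show "x = x'"
      proof (rule nth_equalityI)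
        fix i assume "i < length x"
        then have "i < n" using x(1) length_X by simp
        then obtain Q where "\<forall>x\<in>X. x ! i = poly Q (?y x)"
          using poly_in_one_weight[OF u gen poly_functions.coordinate] by blast
        then show "x ! i = x' ! i" using x by simp
      qed (use x length_X in simp)
    qed
    have Z01: "Z 0 \<subset> Z 1" and Z12: "Z 1 \<subset> Z 2" and Z2: "Z 2 \<subseteq> X"
      and irr: "irreducible_variety n (Z 0)" "irreducible_variety n (Z 1)"
      using Z d by (auto simp: numeral_2_eq_2)
    have Z1: "zariski_closed n (Z 1)" using irr(2) unfolding irreducible_variety_def by blast
    obtain x1 where x1: "x1 \<in> X" "x1 \<notin> Z 1" using Z12 Z2 by blast
    then obtain P where P: "P \<in> poly_functions n" "P x1 \<noteq> 0" "\<And>x. x \<in> Z 1 \<Longrightarrow> P x = 0"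
      using zariski_closed_separate[OF Z1, of x1] zariski_closed_subset[OF closed] by blast
    obtain Q where Q: "\<And>x. x \<in> X \<Longrightarrow> P x = poly Q (?y x)"
      using poly_in_one_weight[OF u gen P(1)] by blast
    have "Q \<noteq> 0" using P(2) Q[OF x1(1)] by auto
    moreover have "?y ` Z 1 \<subseteq> {v. poly Q v = 0}" using P(3) Q Z12 Z2 by force
    ultimately have fin: "finite (?y ` Z 1)" using poly_roots_finite finite_subset by blast
    obtain z where z: "z \<in> Z 0" using irr(1) unfolding irreducible_variety_def by blast
    \<comment> \<open>The zero sets of \<open>f\<close> and \<open>g\<close> split \<open>Z 1\<close> into \<open>{z}\<close> and the rest.\<close>
    define f where "f x = ?y x - ?y z" for x
    define g where "g x = (\<Prod>v\<in>?y ` Z 1 - {?y z}. ?y x - v)" for x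
    define Y where "Y = {x \<in> Z 1. f x = 0}"
    define W where "W = {x \<in> Z 1. g x = 0}"
    have "f \<in> poly_functions n" "g \<in> poly_functions n"
      unfolding f_def g_def
      by (intro poly_functions_prod poly_functions_diff weight_fun(1)[OF u] poly_functions.const)+
    then have "zariski_closed n Y" "zariski_closed n W"
      unfolding Y_def W_def using zariski_closed_zeros[OF Z1] by blast+
    moreover have "Z 1 = Y \<union> W"
      unfolding Y_def W_def f_def g_def using fin by (auto simp: prod_zero_iff)
    ultimately have "Z 1 = Y \<or> Z 1 = W" using irr(2) unfolding irreducible_variety_def by blast
    moreover have "z \<notin> W" unfolding W_def g_def using fin by (auto simp: prod_zero_iff)
    ultimately have "Z 1 = Y" using z Z01 by blast
    moreover have "x = z" if "x \<in> Y" for x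
    proof (rule inj_onD[OF inj])
      show "?y x = ?y z" using that unfolding Y_def f_def by simp
      show "x \<in> X" "z \<in> X" using that z Z01 Z12 Z2 unfolding Y_def by blast+
    qed
    ultimately show False using z Z01 by blast
  qed
qed

end

section \<open>Root automorphisms\<close>

locale root_embedding = torus_embedding n X r act x0
  for n :: nat and X :: "'k::field_char_0 list set" and r act x0 +
  fixes p :: "(nat \<Rightarrow> int) \<Rightarrow> nat" and e :: "nat \<Rightarrow> int"
  assumes height_add: "a \<in> weights \<Longrightarrow> b \<in> weights \<Longrightarrow> p (a + b) = p a + p b"
    and root: "m \<in> weights \<Longrightarrow> p m > 0 \<Longrightarrow> m + e \<in> weights \<and> p m = Suc (p (m + e))"
begin

lemma root_string:
  "m \<in> weights \<Longrightarrow> j \<le> p m \<Longrightarrow> m + of_nat j * e \<in> weights \<and> p m = j + p (m + of_nat j * e)"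
  by (rule root_descent[OF root])

lemma height_zero: "p 0 = 0"
  using height_add[OF weights_zero weights_zero] by simp

text \<open>
  The image of the function with exponent \<open>m\<close> under the automorphism with parameter \<open>s\<close>; it is the binomial
  expansion of \<open>\<chi>\<^sup>m (1 + s \<chi>\<^sup>e)\<^bsup>p(m)\<^esup>\<close>. All exponents in it are weights since each step along the root
  lowers the height by one.
\<close>

definition shifted :: "'k \<Rightarrow> (nat \<Rightarrow> int) \<Rightarrow> 'k list \<Rightarrow> 'k" where
  "shifted s m x = (\<Sum>j\<le>p m. (of_nat (p m choose j) * s ^ j) * weight_fun (m + of_nat j * e) x)"

lemma shifted_poly: "m \<in> weights \<Longrightarrow> shifted s m \<in> poly_functions n"
  unfolding shifted_def
  by (intro poly_functions_sum poly_functions_scale weight_fun(1)) (use root_string in auto)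

lemma shifted_orbit:
  assumes m: "m \<in> weights" and t: "t \<in> torus_points r"
  shows "shifted s m (orb t) = chi r m t * (1 + s * chi r e t) ^ p m"
proof -
  have "shifted s m (orb t)
      = (\<Sum>j\<le>p m. chi r m t * (of_nat (p m choose j) * (s * chi r e t) ^ j * 1 ^ (p m - j)))"
    unfolding shifted_def
  proof (rule sum.cong[OF refl])
    fix j assume "j \<in> {..p m}"
    then have "m + of_nat j * e \<in> weights" using root_string[OF m] by simp
    from weight_fun(2)[OF this t]
    show "of_nat (p m choose j) * s ^ j * weight_fun (m + of_nat j * e) (orb t)
      = chi r m t * (of_nat (p m choose j) * (s * chi r e t) ^ j * 1 ^ (p m - j))"
      by (simp add: chi_add[OF t] chi_of_nat_mult[OF t] power_mult_distrib)
  qed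
  also have "\<dots> = chi r m t * (s * chi r e t + 1) ^ p m"
    unfolding sum_distrib_left[symmetric] binomial_ring ..
  finally show ?thesis by (simp add: add.commute)
qed

text \<open>
  The map of points that corresponds to the algebra endomorphism: each coordinate of \<open>x\<close> is expanded in
  characters, and every character is replaced by its image.
\<close>

definition root_map :: "'k \<Rightarrow> 'k list \<Rightarrow> 'k list" where
  "root_map s x = map (\<lambda>i. \<Sum>a\<in>coord_support i. coord_coeff i a * shifted s a x) [0..<n]"

lemma root_map_nth:
  "i < n \<Longrightarrow> root_map s x ! i = (\<Sum>a\<in>coord_support i. coord_coeff i a * shifted s a x)"
  by (simp add: root_map_def)

lemma root_map_coord_poly:
  "i < n \<Longrightarrow> (\<lambda>x. \<Sum>a\<in>coord_support i. coord_coeff i a * shifted s a x) \<in> poly_functions n"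
  using coord_support(2) by (intro poly_functions_sum poly_functions_scale shifted_poly) blast

lemma poly_root_map: "P \<in> poly_functions n \<Longrightarrow> (\<lambda>x. P (root_map s x)) \<in> poly_functions n"
  unfolding root_map_def by (rule poly_functions_compose[OF _ root_map_coord_poly])

text \<open>
  The coefficients do not depend on the parameter \<open>s\<close>. So they are determined at \<open>s = 0\<close>, where the map
  is the identity; this is how identities on \<open>X\<close> carry over to images under \<open>root_map s\<close> in the next lemmas.
\<close>

lemma poly_root_map_orbit:
  assumes "P \<in> poly_functions n"
  shows "\<exists>A c. finite A \<and> A \<subseteq> weights \<and> (\<forall>t\<in>torus_points r. \<forall>s.
    P (root_map s (orb t)) = (\<Sum>a\<in>A. c a * (chi r a t * (1 + s * chi r e t) ^ p a)))"
proof -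
  let ?ev = "\<lambda>a (t, s). chi r a t * (1 + s * chi r e t) ^ p a"
  let ?Y = "torus_points r \<times> UNIV"
  have "combination ?ev weights ?Y (\<lambda>y. P (root_map (snd y) (orb (fst y))))"
  proof (rule combination_poly_function[OF _ _ _ assms])
    show "\<exists>a\<in>weights. \<forall>y\<in>?Y. ?ev a y = 1"
      by (rule bexI[OF _ weights_zero]) (auto simp: chi_zero height_zero)
    show "\<exists>c\<in>weights. \<forall>y\<in>?Y. ?ev c y = ?ev a y * ?ev b y" if "a \<in> weights" "b \<in> weights" for a b
      by (rule bexI[OF _ weights_add[OF that]]) (auto simp: chi_add height_add[OF that] power_add)
    show "combination ?ev weights ?Y (\<lambda>y. root_map (snd y) (orb (fst y)) ! i)" if i: "i < n" for i
      unfolding combination_def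
    proof (intro exI[of _ "coord_support i"] exI[of _ "coord_coeff i"] conjI ballI)
      show "root_map (snd y) (orb (fst y)) ! i = (\<Sum>a\<in>coord_support i. coord_coeff i a * ?ev a y)"
        if "y \<in> ?Y" for y
        unfolding root_map_nth[OF i] using that coord_support(2)[OF i]
        by (intro sum.cong) (auto simp: shifted_orbit)
    qed (use coord_support[OF i] in auto)
  qed
  then obtain A c where "finite A" "A \<subseteq> weights"
    "\<forall>y\<in>?Y. P (root_map (snd y) (orb (fst y))) = (\<Sum>a\<in>A. c a * ?ev a y)"
    unfolding combination_def by blast
  then show ?thesis by (intro exI[of _ A] exI[of _ c]) auto
qed

lemma root_map_0:
  assumes "t \<in> torus_points r"
  shows "root_map 0 (orb t) = orb t"
proof (rule nth_equalityI)
  show "length (root_map 0 (orb t)) = length (orb t)"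
    using length_X[OF orb_closed[OF assms]] by (simp add: root_map_def)
  fix i assume "i < length (root_map 0 (orb t))"
  then have i: "i < n" by (simp add: root_map_def)
  show "root_map 0 (orb t) ! i = orb t ! i"
    unfolding root_map_nth[OF i] coord_support(3)[OF i orb_closed[OF assms]]
    using coord_support(2)[OF i] assms
    by (intro sum.cong) (auto simp: shifted_orbit weight_fun(2))
qed

text \<open>
  A polynomial vanishing on \<open>X\<close> has zero coefficients by the case \<open>s = 0\<close>, so it also vanishes at all
  images of orbit points, and by density at all images of points of \<open>X\<close>.
\<close>

lemma root_map_closed:
  assumes "x \<in> X"
  shows "root_map s x \<in> X"
proof (rule ccontr)
  assume "root_map s x \<notin> X"
  then obtain P where P: "P \<in> poly_functions n" "P (root_map s x) \<noteq> 0" "\<And>y. y \<in> X \<Longrightarrow> P y = 0"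
    using zariski_closed_separate[OF closed, of "root_map s x"]
    by (auto simp: affine_space_def root_map_def)
  obtain A c where A: "finite A" "A \<subseteq> weights" "\<And>t s. t \<in> torus_points r \<Longrightarrow>
      P (root_map s (orb t)) = (\<Sum>a\<in>A. c a * (chi r a t * (1 + s * chi r e t) ^ p a))"
    using poly_root_map_orbit[OF P(1)] by blast
  have "(\<Sum>a\<in>A. c a * chi r a t) = 0" if t: "t \<in> torus_points r" for t :: "'k list"
    using A(3)[OF t, of 0] P(3)[OF orb_closed[OF t]] root_map_0[OF t] by simp
  then have "c a = 0" if "a \<in> A" for a
    using chi_independent[OF A(1), of r c a] A(2) weights_exponents that by blast
  then have "P (root_map s (orb t)) = 0" if "t \<in> torus_points r" for t :: "'k list"
    using A(3)[OF that] by simp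
  then have "P (root_map s x) = 0"
    using orbit_dense[OF poly_root_map[OF P(1)] _ assms] by blast
  then show False using P(2) by contradiction
qed

lemma weight_fun_root_map:
  assumes m: "m \<in> weights" and x: "x \<in> X"
  shows "weight_fun m (root_map s x) = shifted s m x"
proof -
  obtain A c where A: "finite A" "A \<subseteq> weights" "\<And>t s. t \<in> torus_points r \<Longrightarrow>
      weight_fun m (root_map s (orb t)) = (\<Sum>a\<in>A. c a * (chi r a t * (1 + s * chi r e t) ^ p a))"
    using poly_root_map_orbit[OF weight_fun(1)[OF m]] by blast
  have at0: "(\<Sum>a\<in>A. c a * chi r a t) = chi r m t" if t: "t \<in> torus_points r" for t :: "'k list"
    using A(3)[OF t, of 0] weight_fun(2)[OF m t] root_map_0[OF t] by simp
  have c0: "c a = 0" if "a \<in> A" "a \<noteq> m" for a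
    using chi_combination_unique[of A "{m}" r c "\<lambda>_. 1" a] A(1,2) weights_exponents m at0 that by auto
  have collapse: "(\<Sum>a\<in>A. c a * f a) = (if m \<in> A then c m else 0) * f m" for f :: "_ \<Rightarrow> 'k"
  proof -
    have "(\<Sum>a\<in>A. c a * f a) = (\<Sum>a\<in>A. if a = m then c m * f m else 0)"
      using c0 by (intro sum.cong) auto
    then show ?thesis using A(1) by simp
  qed
  have "(if m \<in> A then c m else 0) = 1"
    using at0[OF torus_one_closed] unfolding collapse by (simp add: chi_one)
  then have "weight_fun m (root_map s (orb t)) = shifted s m (orb t)" if "t \<in> torus_points r" for t :: "'k list"
    using A(3)[OF that] shifted_orbit[OF m that] unfolding collapse by simp
  then show ?thesis
    using orbit_dense_eq[OF poly_root_map[OF weight_fun(1)[OF m]] shifted_poly[OF m] _ x] by blast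
qed

text \<open>
  On the orbit the binomial formula gives \<open>\<chi>\<^sup>m (- s \<chi>\<^sup>e + (1 + s \<chi>\<^sup>e))\<^bsup>p(m)\<^esup> = \<chi>\<^sup>m\<close>.
\<close>

lemma shifted_root_map:
  assumes m: "m \<in> weights" and x: "x \<in> X"
  shows "shifted (- s) m (root_map s x) = weight_fun m x"
proof (rule orbit_dense_eq[OF poly_root_map[OF shifted_poly[OF m]] weight_fun(1)[OF m] _ x])
  fix t :: "'k list" assume t: "t \<in> torus_points r"
  have "shifted (- s) m (root_map s (orb t))
      = (\<Sum>j\<le>p m. of_nat (p m choose j) * (- s) ^ j * shifted s (m + of_nat j * e) (orb t))"
    unfolding shifted_def[of "- s"]
    using root_string[OF m] orb_closed[OF t] by (intro sum.cong) (auto simp: weight_fun_root_map)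
  also have "\<dots> = (\<Sum>j\<le>p m. chi r m t *
      (of_nat (p m choose j) * (- s * chi r e t) ^ j * (1 + s * chi r e t) ^ (p m - j)))"
  proof (rule sum.cong[OF refl])
    fix j assume "j \<in> {..p m}"
    then have j: "m + of_nat j * e \<in> weights" "p (m + of_nat j * e) = p m - j"
      using root_string[OF m, of j] by auto
    show "of_nat (p m choose j) * (- s) ^ j * shifted s (m + of_nat j * e) (orb t)
      = chi r m t * (of_nat (p m choose j) * (- s * chi r e t) ^ j * (1 + s * chi r e t) ^ (p m - j))"
      unfolding shifted_orbit[OF j(1) t] j(2) chi_add[OF t] chi_of_nat_mult[OF t] power_mult_distrib
      by (simp only: mult.assoc mult.commute mult.left_commute)
  qed
  also have "\<dots> = chi r m t * (- s * chi r e t + (1 + s * chi r e t)) ^ p m"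
    unfolding sum_distrib_left[symmetric] binomial_ring ..
  finally show "shifted (- s) m (root_map s (orb t)) = weight_fun m (orb t)"
    by (simp add: weight_fun(2)[OF m t])
qed

lemma root_map_inverse:
  assumes x: "x \<in> X"
  shows "root_map (- s) (root_map s x) = x"
proof (rule nth_equalityI)
  show "length (root_map (- s) (root_map s x)) = length x"
    using length_X[OF x] by (simp add: root_map_def)
  fix i assume "i < length (root_map (- s) (root_map s x))"
  then have i: "i < n" by (simp add: root_map_def)
  show "root_map (- s) (root_map s x) ! i = x ! i"
    unfolding root_map_nth[OF i] coord_support(3)[OF i x]
    using coord_support(2)[OF i] x by (intro sum.cong) (auto simp: shifted_root_map)
qed

lemma root_map_automorphism: "restrict (root_map s) X \<in> carrier (variety_aut_group n X)"
proof -
  let ?f = "restrict (root_map s) X"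
  have inv: "root_map s (root_map (- s) x) = x" if "x \<in> X" for x
    using root_map_inverse[OF that, of "- s"] by simp
  have bij: "bij_betw ?f X X"
    by (rule bij_betw_byWitness[of _ "root_map (- s)"])
      (auto simp: root_map_closed root_map_inverse inv)
  have morph: "morphism n X n X f" if "\<And>x. x \<in> X \<Longrightarrow> f x = root_map s x" for f s
    unfolding morphism_def coord_ring_carrier_iff
  proof (intro conjI allI impI)
    show "f ` X \<subseteq> X" using that root_map_closed by auto
    fix j assume j: "j < n"
    show "\<exists>q\<in>poly_functions n. (\<lambda>x\<in>X. f x ! j) = restrict q X"
      using that by (intro bexI[OF _ root_map_coord_poly[OF j, of s]]) (auto simp: root_map_nth[OF j] fun_eq_iff)
  qed
  have "inv_into X ?f x = root_map (- s) x" if "x \<in> X" for x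
  proof (rule inv_into_f_eq)
    show "inj_on ?f X" using bij bij_betw_def by blast
    show "?f (root_map (- s) x) = x" using inv that root_map_closed by simp
  qed (use root_map_closed that in blast)
  then have "morphism n X n X (inv_into X ?f)" by (rule morph)
  moreover have "morphism n X n X ?f" by (rule morph[of _ s]) simp
  ultimately show ?thesis using bij unfolding variety_aut_group_def by (simp add: Bij_def)
qed

text \<open>
  The binomial expansion of \<open>\<chi>\<^sup>m (1 + \<chi>\<^sup>e)\<^bsup>p(m)\<^esup>\<close> has distinct exponents, since their heights differ, and the last one
  occurs with coefficient \<open>1\<close>.
\<close>

lemma shifted_top_exponent:
  assumes m: "m \<in> weights" and B: "finite B" "B \<subseteq> weights"
    and eq: "\<And>t. t \<in> torus_points r \<Longrightarrow> shifted 1 m (orb t) = (\<Sum>b\<in>B. d b * chi r b t)"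
  shows "m + of_nat (p m) * e \<in> B"
proof -
  let ?m = "\<lambda>j. m + of_nat j * e"
  have inj: "inj_on ?m {..p m}"
  proof (rule inj_onI)
    fix i j assume "i \<in> {..p m}" "j \<in> {..p m}" "?m i = ?m j"
    then show "i = j" using root_string[OF m, of i] root_string[OF m, of j] by auto
  qed
  \<comment> \<open>The index \<open>j\<close> of an exponent in the expansion is recovered from its height \<open>p m - j\<close>.\<close>
  define c where "c a = (of_nat (p m choose (p m - p a)) :: 'k)" for a
  have "(\<Sum>a\<in>?m ` {..p m}. c a * chi r a t) = (\<Sum>b\<in>B. d b * chi r b t)" if t: "t \<in> torus_points r" for t :: "'k list"
  proof -
    have "(\<Sum>a\<in>?m ` {..p m}. c a * chi r a t) = (\<Sum>j\<le>p m. c (?m j) * chi r (?m j) t)"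
      by (rule sum.reindex[OF inj, unfolded comp_def])
    also have "\<dots> = (\<Sum>j\<le>p m. of_nat (p m choose j) * weight_fun (?m j) (orb t))"
    proof (rule sum.cong[OF refl])
      fix j assume "j \<in> {..p m}"
      then have "?m j \<in> weights" "p m - p (?m j) = j" using root_string[OF m, of j] by auto
      then show "c (?m j) * chi r (?m j) t = of_nat (p m choose j) * weight_fun (?m j) (orb t)"
        using weight_fun(2)[OF _ t] by (simp add: c_def)
    qed
    also have "\<dots> = shifted 1 m (orb t)" unfolding shifted_def by simp
    finally show ?thesis using eq[OF t] by simp
  qed
  moreover have "p (?m (p m)) = 0" using root_string[OF m order_refl] by simp
  then have "c (?m (p m)) \<noteq> 0" by (simp add: c_def)
  moreover have "?m ` {..p m} \<subseteq> exponents r" using root_string[OF m] weights_exponents by auto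
  ultimately show ?thesis
    using B weights_exponents chi_combination_unique[of "?m ` {..p m}" B r c d "?m (p m)"] by blast
qed

end

section \<open>Algebraic actions\<close>

lemma poly_functions_append:
  assumes "p \<in> poly_functions m" "length y = m"
  shows "p (y @ x) = p y"
  using assms(1) by induction (simp_all add: nth_append assms(2))

lemma poly_functions_mono:
  assumes "p \<in> poly_functions m" "m \<le> n"
  shows "p \<in> poly_functions n"
  using assms(1) by induction (use assms(2) in \<open>auto intro: poly_functions.intros\<close>)

lemma morphism_coordinate:
  assumes "morphism m X n Y f" "j < n"
  shows "\<exists>P\<in>poly_functions m. \<forall>x\<in>X. f x ! j = P x"
proof -
  have "(\<lambda>x\<in>X. f x ! j) \<in> carrier (coord_ring m X)"
    using assms unfolding morphism_def by blast
  then obtain P where P: "P \<in> poly_functions m" "(\<lambda>x\<in>X. f x ! j) = restrict P X"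
    unfolding coord_ring_carrier_iff by blast
  have "f x ! j = P x" if "x \<in> X" for x
    using fun_cong[OF P(2), of x] that by simp
  then show ?thesis using P(1) by blast
qed

lemma algebraic_action_coordinate:
  assumes "algebraic_action m G n X \<phi>" "carrier G \<subseteq> affine_space m" "i < n"
  shows "\<exists>P\<in>poly_functions (m + n). \<forall>g\<in>carrier G. \<forall>x\<in>X. \<phi> g x ! i = P (g @ x)"
proof -
  have "morphism (m + n) (variety_prod (carrier G) X) n X (\<lambda>z. \<phi> (take m z) (drop m z))"
    using assms(1) unfolding algebraic_action_def by blast
  from morphism_coordinate[OF this assms(3)] obtain P where P: "P \<in> poly_functions (m + n)"
    "\<forall>z\<in>variety_prod (carrier G) X. \<phi> (take m z) (drop m z) ! i = P z" ..
  have "\<phi> g x ! i = P (g @ x)" if "g \<in> carrier G" "x \<in> X" for g x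
  proof -
    have "g @ x \<in> variety_prod (carrier G) X" using that unfolding variety_prod_def by blast
    moreover have "length g = m" using that(1) assms(2) by (auto simp: affine_space_def)
    ultimately show ?thesis using bspec[OF P(2), of "g @ x"] by simp
  qed
  then show ?thesis using P(1) by blast
qed

text \<open>
  The action is transported along the inverse \<open>g\<close> of an isomorphism from the given torus \<open>T\<close> to the standard one.
\<close>

lemma affine_toric_variety_embedding:
  fixes X :: "'k::field_char_0 list set"
  assumes toric: "affine_toric_variety n X"
    and units: "Units (coord_ring n X) = {\<lambda>x\<in>X. c | c. c \<noteq> 0}"
  shows "\<exists>r act x0. torus_embedding n X r act x0"
proof -
  obtain m T \<phi> x0 where T: "algebraic_torus m T" "algebraic_action m T n X \<phi>"
    "x0 \<in> X" "open_in_variety n X (orbit T \<phi> x0)"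
    using toric unfolding affine_toric_variety_def by blast
  obtain r f where f: "algebraic_group_iso m T (2 * r) (standard_torus r) f"
    using T(1) unfolding algebraic_torus_def by blast
  define g where "g = inv_into (carrier T) f"
  have grp: "group T" and Tlen: "carrier T \<subseteq> affine_space m"
    using T(1) zariski_closed_subset unfolding algebraic_torus_def affine_algebraic_group_def by auto
  interpret group_action T X \<phi> using T(2) unfolding algebraic_action_def by blast
  have g_iso: "g \<in> iso (standard_torus r) T"
    unfolding g_def using group.iso_set_sym[OF grp] f unfolding algebraic_group_iso_def by blast
  have g_closed: "g t \<in> carrier T" if "t \<in> torus_points r" for t
    using g_iso that by (auto simp: iso_def hom_def)
  have g_mult: "g (map2 (*) s t) = g s \<otimes>\<^bsub>T\<^esub> g t" if "s \<in> torus_points r" "t \<in> torus_points r" for s t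
    using hom_mult[of g "standard_torus r" T s t] g_iso that by (simp add: iso_def torus_mult)
  have g_image: "g ` torus_points r = carrier T"
    using g_iso by (auto simp: iso_def bij_betw_def)
  have g_one: "g (replicate (2 * r) 1) = \<one>\<^bsub>T\<^esub>"
  proof -
    let ?e = "replicate (2 * r) 1 :: 'k list"
    have "map2 (*) ?e ?e = ?e" by (rule nth_equalityI) simp_all
    then have "g ?e \<otimes>\<^bsub>T\<^esub> g ?e = g ?e"
      using g_mult[OF torus_one_closed torus_one_closed] by simp
    then show ?thesis using group.r_cancel_one[OF grp] g_closed[OF torus_one_closed] by blast
  qed
  obtain q where q: "\<And>j. j < m \<Longrightarrow> q j \<in> poly_functions (2 * r)"
    "\<And>j t. j < m \<Longrightarrow> t \<in> torus_points r \<Longrightarrow> g t ! j = q j t"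
  proof -
    have "morphism (2 * r) (torus_points r) m (carrier T) g"
      using f unfolding g_def algebraic_group_iso_def by blast
    from morphism_coordinate[OF this] have "\<forall>j\<in>{..<m}. \<exists>q. q \<in> poly_functions (2 * r) \<and> (\<forall>t\<in>torus_points r. g t ! j = q t)"
      by blast
    from bchoice[OF this] obtain q where "\<forall>j\<in>{..<m}. q j \<in> poly_functions (2 * r) \<and>
        (\<forall>t\<in>torus_points r. g t ! j = q j t)" ..
    then show ?thesis by (intro that[of q]) simp_all
  qed
  have "torus_embedding n X r (\<lambda>t. \<phi> (g t)) x0"
  proof
    show "irreducible_variety n X" "normal_variety n X"
      using toric unfolding affine_toric_variety_def by blast+
    show "Units (coord_ring n X) = {\<lambda>x\<in>X. c | c. c \<noteq> 0}" by (rule units)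
    show "\<phi> (g t) x \<in> X" if "t \<in> torus_points r" "x \<in> X" for t x
      using element_image[OF g_closed[OF that(1)] that(2)] by blast
    show "\<phi> (g (replicate (2 * r) 1)) x = x" if "x \<in> X" for x
      using fun_cong[OF id_eq_one, of x] that unfolding g_one by simp
    show "\<phi> (g (map2 (*) s t)) x = \<phi> (g s) (\<phi> (g t) x)"
      if "s \<in> torus_points r" "t \<in> torus_points r" "x \<in> X" for s t x
      using composition_rule[OF that(3) g_closed[OF that(1)] g_closed[OF that(2)]] g_mult[OF that(1,2)]
      by simp
    show "x0 \<in> X" by (rule T(3))
    have "orbit T \<phi> x0 = (\<lambda>t. \<phi> (g t) x0) ` torus_points r"
      unfolding orbit_def g_image[symmetric] by blast
    then show "zariski_closed n (X - (\<lambda>t. \<phi> (g t) x0) ` torus_points r)"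
      using T(4) unfolding open_in_variety_def by simp
    fix i assume "i < n"
    then obtain P where P: "P \<in> poly_functions (m + n)"
      "\<And>\<tau> x. \<tau> \<in> carrier T \<Longrightarrow> x \<in> X \<Longrightarrow> \<phi> \<tau> x ! i = P (\<tau> @ x)"
      using algebraic_action_coordinate[OF T(2) Tlen] by blast
    define R where "R j z = (if j < m then q j z else z ! (2 * r + (j - m)))" for j and z :: "'k list"
    have R: "R j \<in> poly_functions (2 * r + n)" if "j < m + n" for j
    proof (cases "j < m")
      case True
      then show ?thesis using poly_functions_mono[OF q(1)[OF True]] by (simp add: R_def[abs_def])
    next
      case False
      then show ?thesis using that by (auto simp: R_def[abs_def] intro!: poly_functions.coordinate)
    qed
    show "\<exists>P\<in>poly_functions (2 * r + n). \<forall>t\<in>torus_points r. \<forall>x\<in>X. \<phi> (g t) x ! i = P (t @ x)"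
    proof (intro bexI[OF _ poly_functions_compose[OF P(1) R]] ballI)
      fix t x :: "'k list" assume t: "t \<in> torus_points r" and x: "x \<in> X"
      have len: "length (g t) = m" "length x = n" "length t = 2 * r"
        using g_closed[OF t] Tlen x toric t zariski_closed_subset[of n X]
        by (auto simp: affine_space_def affine_toric_variety_def irreducible_variety_def torus_points_iff)
      have "map (\<lambda>j. R j (t @ x)) [0..<m + n] = g t @ x"
        using len q(2)[OF _ t] poly_functions_append[OF q(1)]
        by (intro nth_equalityI) (auto simp: R_def nth_append)
      then show "\<phi> (g t) x ! i = P (map (\<lambda>j. R j (t @ x)) [0..<m + n])"
        using P(2)[OF g_closed[OF t] x] by simp
    qed
  qed
  then show ?thesis by blast
qed

context torus_embedding
begin

text \<open>
  The translates of \<open>P\<close> span a finite-dimensional space: separating the variables in \<open>P (g x)\<close> writes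
  every translate as a combination of finitely many functions of \<open>x\<close>, and each of these involves
  finitely many characters.
\<close>

lemma algebraic_action_bounded_exponents:
  assumes "algebraic_action m G n X \<psi>" "carrier G \<subseteq> affine_space m" and P: "P \<in> poly_functions n"
  shows "\<exists>B. finite B \<and> B \<subseteq> weights \<and>
    (\<forall>g\<in>carrier G. \<exists>d. \<forall>t\<in>torus_points r. P (\<psi> g (orb t)) = (\<Sum>b\<in>B. d b * chi r b t))"
proof -
  have "\<forall>i\<in>{..<n}. \<exists>R. R \<in> poly_functions (m + n) \<and> (\<forall>g\<in>carrier G. \<forall>x\<in>X. \<psi> g x ! i = R (g @ x))"
    using algebraic_action_coordinate[OF assms(1,2)] by blast
  from bchoice[OF this] obtain R where R: "\<And>i. i < n \<Longrightarrow> R i \<in> poly_functions (m + n)"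
    "\<And>i g x. i < n \<Longrightarrow> g \<in> carrier G \<Longrightarrow> x \<in> X \<Longrightarrow> \<psi> g x ! i = R i (g @ x)"
    by auto
  interpret group_action G X \<psi> using assms(1) unfolding algebraic_action_def by blast
  have "(\<lambda>z. P (map (\<lambda>i. R i z) [0..<n])) \<in> poly_functions (m + n)"
    by (rule poly_functions_compose[OF P R(1)])
  from separate_variables[OF this] obtain A c where A: "finite A" "A \<subseteq> poly_functions m \<times> poly_functions n"
    and sep: "\<forall>y x. length y = m \<longrightarrow>
      P (map (\<lambda>i. R i (y @ x)) [0..<n]) = (\<Sum>(p, q)\<in>A. c (p, q) * (p y * q x))"
    by (elim exE conjE) (rule that)
  have expand: "P (\<psi> g x) = (\<Sum>(p, q)\<in>A. c (p, q) * (p g * q x))" if "g \<in> carrier G" "x \<in> X" for g x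
  proof -
    have "\<psi> g x = map (\<lambda>i. R i (g @ x)) [0..<n]"
      using R(2) that length_X[OF element_image[OF that refl]] by (intro nth_equalityI) auto
    then show ?thesis using sep[rule_format, of g x] that(1) assms(2) by (auto simp: affine_space_def)
  qed
  have "\<forall>a\<in>A. \<exists>B. finite B \<and> B \<subseteq> weights \<and>
      (\<exists>d. \<forall>t\<in>torus_points r. snd a (orb t) = (\<Sum>b\<in>B. d b * chi r b t))"
  proof
    fix a assume "a \<in> A"
    then have "snd a \<in> poly_functions n" using A(2) by auto
    from combination_orbit[OF this] show "\<exists>B. finite B \<and> B \<subseteq> weights \<and>
      (\<exists>d. \<forall>t\<in>torus_points r. snd a (orb t) = (\<Sum>b\<in>B. d b * chi r b t))"
      unfolding combination_def by simp
  qed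
  from bchoice[OF this] obtain B where B: "\<forall>a\<in>A. finite (B a) \<and> B a \<subseteq> weights \<and>
      (\<exists>d. \<forall>t\<in>torus_points r. snd a (orb t) = (\<Sum>b\<in>B a. d b * chi r b t))" ..
  then have "\<forall>a\<in>A. \<exists>d. \<forall>t\<in>torus_points r. snd a (orb t) = (\<Sum>b\<in>B a. d b * chi r b t)" by blast
  from bchoice[OF this] obtain d where
    d: "\<forall>a\<in>A. \<forall>t\<in>torus_points r. snd a (orb t) = (\<Sum>b\<in>B a. d a b * chi r b t)" ..
  define C where "C = (\<Union>a\<in>A. B a)"
  have C: "finite C" "C \<subseteq> weights" using A(1) B unfolding C_def by auto
  define D where "D g b = (\<Sum>a\<in>A. c a * fst a g * (if b \<in> B a then d a b else 0))" for g b
  have "P (\<psi> g (orb t)) = (\<Sum>b\<in>C. D g b * chi r b t)"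
    if g: "g \<in> carrier G" and t: "t \<in> torus_points r" for g and t :: "'k list"
  proof -
    have "snd a (orb t) = (\<Sum>b\<in>C. (if b \<in> B a then d a b else 0) * chi r b t)" if a: "a \<in> A" for a
    proof -
      have "snd a (orb t) = (\<Sum>b\<in>B a. (if b \<in> B a then d a b else 0) * chi r b t)"
        using d a t by simp
      also have "\<dots> = (\<Sum>b\<in>C. (if b \<in> B a then d a b else 0) * chi r b t)"
        using C(1) a unfolding C_def by (intro sum.mono_neutral_left) auto
      finally show ?thesis .
    qed
    then have "P (\<psi> g (orb t)) = (\<Sum>a\<in>A. c a * (fst a g * (\<Sum>b\<in>C. (if b \<in> B a then d a b else 0) * chi r b t)))"
      using expand[OF g orb_closed[OF t]] by (simp add: case_prod_unfold)
    also have "\<dots> = (\<Sum>a\<in>A. \<Sum>b\<in>C. c a * fst a g * (if b \<in> B a then d a b else 0) * chi r b t)"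
      by (simp only: sum_distrib_left mult.assoc)
    also have "\<dots> = (\<Sum>b\<in>C. \<Sum>a\<in>A. c a * fst a g * (if b \<in> B a then d a b else 0) * chi r b t)"
      by (rule sum.swap)
    finally show ?thesis unfolding D_def sum_distrib_right .
  qed
  then have "\<exists>d. \<forall>t\<in>torus_points r. P (\<psi> g (orb t)) = (\<Sum>b\<in>C. d b * chi r b t)"
    if "g \<in> carrier G" for g
    using that by (intro exI[of _ "D g"]) simp
  then show ?thesis using C by (intro exI[of _ C]) simp
qed

text \<open>
  Every \<open>e + k w\<close> is again a root. The automorphism that belongs to it forces its top exponent, starting
  at \<open>m0\<close>, into a finite set \<open>B\<close> that does not depend on \<open>k\<close>.
\<close>

lemma root_not_finite_dimensional:
  assumes p_add: "\<And>a b. a \<in> weights \<Longrightarrow> b \<in> weights \<Longrightarrow> p (a + b) = p a + (p b :: nat)"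
    and root: "\<And>m. m \<in> weights \<Longrightarrow> p m > 0 \<Longrightarrow> m + e \<in> weights \<and> p m = Suc (p (m + e))"
    and w: "w \<in> weights" "w \<noteq> 0" "p w = 0"
    and m0: "m0 \<in> weights" "p m0 > 0"
  shows "\<not> aut_finite_dimensional n X"
proof
  assume "aut_finite_dimensional n X"
  then obtain m G \<psi> where G: "affine_algebraic_group m G" "\<psi> \<in> iso G (variety_aut_group n X)"
    "algebraic_action m G n X \<psi>"
    unfolding aut_finite_dimensional_def by blast
  have "carrier G \<subseteq> affine_space m"
    using G(1) zariski_closed_subset unfolding affine_algebraic_group_def by blast
  then obtain B where B: "finite B" "B \<subseteq> weights"
    "\<And>g. g \<in> carrier G \<Longrightarrow> \<exists>d. \<forall>t\<in>torus_points r. weight_fun m0 (\<psi> g (orb t)) = (\<Sum>b\<in>B. d b * chi r b t)"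
    using algebraic_action_bounded_exponents[OF G(3) _ weight_fun(1)[OF m0(1)]] by blast
  have in_B: "m0 + of_nat (p m0) * (e + of_nat k * w) \<in> B" for k
  proof -
    have pkw: "p (of_nat k * w) = 0"
    proof (induction k)
      case 0
      have "p 0 = 0" using p_add[OF weights_zero weights_zero] by simp
      then show ?case by (simp only: of_nat_0 mult_zero_left)
    next
      case (Suc k)
      have eq: "of_nat (Suc k) * w = w + of_nat k * w"
        by (simp only: of_nat_Suc distrib_right mult_1_left)
      show ?case unfolding eq p_add[OF w(1) weights_mult[OF w(1)]] w(3) Suc by simp
    qed
    interpret R: root_embedding n X r act x0 p "e + of_nat k * w"
    proof
      fix m assume m: "m \<in> weights" "p m > 0"
      have me: "m + e \<in> weights" "p m = Suc (p (m + e))" using root[OF m] by auto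
      have assoc: "m + (e + of_nat k * w) = (m + e) + of_nat k * w" by (simp only: add.assoc)
      show "m + (e + of_nat k * w) \<in> weights \<and> p m = Suc (p (m + (e + of_nat k * w)))"
        unfolding assoc p_add[OF me(1) weights_mult[OF w(1)]] pkw
        using me weights_add[OF me(1) weights_mult[OF w(1)]] by simp
    qed (rule p_add)
    have "restrict (R.root_map 1) X \<in> \<psi> ` carrier G"
      using R.root_map_automorphism G(2) by (auto simp: iso_def bij_betw_def)
    then obtain g where g: "g \<in> carrier G" "\<psi> g = restrict (R.root_map 1) X" by auto
    obtain d where d: "\<And>t. t \<in> torus_points r \<Longrightarrow> weight_fun m0 (\<psi> g (orb t)) = (\<Sum>b\<in>B. d b * chi r b t)"
      using B(3)[OF g(1)] by blast
    show ?thesis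
    proof (rule R.shifted_top_exponent[OF m0(1) B(1,2)])
      fix t :: "'k list" assume t: "t \<in> torus_points r"
      show "R.shifted 1 m0 (orb t) = (\<Sum>b\<in>B. d b * chi r b t)"
        using d[OF t] g(2) orb_closed[OF t] R.weight_fun_root_map[OF m0(1) orb_closed[OF t]] by simp
    qed
  qed
  have "inj (\<lambda>k. m0 + of_nat (p m0) * (e + of_nat k * w))"
  proof (rule injI)
    fix k l assume *: "m0 + of_nat (p m0) * (e + of_nat k * w) = m0 + of_nat (p m0) * (e + of_nat l * w)"
    obtain i where "w i \<noteq> 0" using w(2) by (auto simp: fun_eq_iff)
    then show "k = l" using fun_cong[OF *, of i] m0(2) by (simp add: of_nat_fun)
  qed
  then have "infinite (range (\<lambda>k. m0 + of_nat (p m0) * (e + of_nat k * w)))"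
    using finite_imageD infinite_UNIV_nat by blast
  moreover have "range (\<lambda>k. m0 + of_nat (p m0) * (e + of_nat k * w)) \<subseteq> B"
    using in_B by (rule image_subsetI)
  ultimately show False using B(1) finite_subset by blast
qed

end

section \<open>Automorphism groups of affine toric varieties\<close>

theorem theorem5p4:
  fixes X :: "'k::{field_char_0, alg_closed_field} list set" and n :: nat
  assumes "affine_toric_variety n X"
    and "variety_dim n X \<ge> 2"
    and "Units (coord_ring n X) = {\<lambda>x\<in>X. c | c. c \<noteq> 0}"
  shows "\<not> aut_finite_dimensional n X"
proof -
  obtain r act x0 where "torus_embedding n X r act x0"
    using affine_toric_variety_embedding[OF assms(1,3)] by blast
  then interpret torus_embedding n X r act x0 .
  obtain A where "fg_monoid weights A" using fg_monoid_weights by blast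
  then interpret M: fg_monoid weights A .
  have "\<not> (\<exists>u\<in>weights. \<forall>m\<in>weights. \<exists>k. m = of_nat k * u)"
  proof
    assume "\<exists>u\<in>weights. \<forall>m\<in>weights. \<exists>k. m = of_nat k * u"
    then have "variety_dim n X \<le> 1" using dim_one_weight by blast
    then have "(2 :: enat) \<le> 1" using assms(2) by (rule order_trans[rotated])
    then show False by simp
  qed
  then obtain p e w m0 where "\<forall>a\<in>weights. \<forall>b\<in>weights. p (a + b) = p a + (p b :: nat)"
    "\<forall>m\<in>weights. p m > 0 \<longrightarrow> m + e \<in> weights \<and> p m = Suc (p (m + e))"
    "w \<in> weights" "w \<noteq> 0" "p w = 0" "m0 \<in> weights" "p m0 > 0"
    using M.ray_or_root by blast
  then show ?thesis by (intro root_not_finite_dimensional[of p e w m0]) simp_all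
qed

end
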